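(* Let $\varepsilon:\mathbf{Set}\to\mathbf{CTop}_2$ be a contravariant functor sending coproducts to products, let $*$ be a singleton and let $K=\varepsilon( * )$ have more than one element. Then: (a) the pair $(\mathfrak h,h_{top})$ satisfies $BT_{\varepsilon,\infty}$, if $K$ is infinite; (b) the pair $(\mathbf h_{\mathfrak{im}},\mathbf h_{\mathfrak{cov}})$ satisfies $SBT^w_{\varepsilon,\log|K|}$, if $K$ is finite. In particular, the pair $(\mathfrak h,h_{top})$ satisfies $BT_{\varepsilon,\log|K|}$ (with the convention that $\log|K|=\infty$ if $K$ is infinite).
   Context: $\mathbf{Set}$ is the category of sets and maps; $\mathbf{CTop}_2$ is the category of compact Hausdorff spaces and continuous maps. $\varepsilon$ sends coproducts to products if for every family of sets (including the empty one) with coproduct $X=\bigsqcup_iX_i$ and canonical maps $\iota_i:X_i\to X$, $\varepsilon(X)$ with the morphisms $\varepsilon(\iota_i)$ is a product of the $\varepsilon(X_i)$ in $\mathbf{CTop}_2$. A normed semigroup $(S,v)$ is a semigroup with a function $v:S\to\mathbb R_{\ge0}$; $\mathfrak S^*$ is the category of normed semigroups and all semigroup homomorphisms, $\mathfrak S$ the subcategory with the same objects and only contractive homomorphisms ($v'(\phi(x))\le v(x)$). For an endomorphism $\phi$ of $(S,v)$, $T_n(\phi,x)=x\cdot\phi(x)\cdots\phi^{n-1}(x)$ and $h_{\mathfrak S}(\phi)=\sup_{x\in S}\limsup_{n}\frac{v(T_n(\phi,x))}{n}$; for a functor $F$ to $\mathfrak S$, $\mathbf h_F(\phi)=h_{\mathfrak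 S}(F(\phi))$. A homomorphism $\alpha:(S,v)\to(T,w)$ in $\mathfrak S^*$, with $T$ preordered, is a weak isomorphism with coefficient $r>0$ if $\alpha$ is injective, $w(\alpha(x))=r\,v(x)$ for all $x\in S$, and $\alpha(S)$ is cofinal in $T$ (every $t\in T$ satisfies $t\le\alpha(s)$ for some $s$). For functors $\varepsilon:\mathfrak X_1\to\mathfrak X_2$, $F_i$ on $\mathfrak X_i$ with values in normed preordered semigroups (with $F_1$ and $F_2\varepsilon$ of the same variance), $(\mathbf h_{F_1},\mathbf h_{F_2})$ satisfies $SBT^w_{\varepsilon,C}$, $0<C\in\mathbb R$, if there is a natural transformation $\eta:F_1\to F_2\varepsilon$ (in $\mathfrak S^*$) with every $\eta_X$ a weak isomorphism with coefficient $C$. A pair of entropies $(h_1,h_2)$ satisfies $BT_{\varepsilon,C}$, $0<C\le\infty$, if $h_2(\varepsilon(\phi))=C\,h_1(\phi)$ for every endomorphism $\phi$ in $\mathfrak X_1$, where $\infty\cdot0=0$ and $\infty\cdot a=\infty$ for $a>0$. For a selfmap $\lambda:X\to X$ of a set, $\mathcal S(X)$ is the set of all finite subsets of $X$ and $\mathfrak h(\lambda)=\sup_{D\in\mathcal S(X)}\lim_n\frac{|D\cup\lambda(D)\cup\dots\cup\lambda^{n-1}(D)|}{n}$. The covariant functor $\mathfrak{im}$ on $\mathbf{Set}$ is $\mathfrak{im}(X)=(\mathcal S(X),\cup)$ with norm $v(A)=|A|$ and order $\subseteq$, $\mathfrak{im}(\lambda):A\mapsto\lambda(A)$. For a compact space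 $X$, $\mathfrak{cov}(X)$ is the set of all open covers of $X$ (the empty set is allowed to be a member of a cover), with operation $\mathcal U\vee\mathcal V=\{U\cap V:U\in\mathcal U,V\in\mathcal V\}$, norm $v(\mathcal U)=\log N(\mathcal U)$, where $N(\mathcal U)$ is the minimal cardinality of a finite subcover of $\mathcal U$, and preorder $\mathcal U\prec\mathcal V$ iff every $V\in\mathcal V$ is contained in some $U\in\mathcal U$. For a continuous map $\phi:X\to Y$, $\mathfrak{cov}(\phi):\mathfrak{cov}(Y)\to\mathfrak{cov}(X)$ is $\mathcal U\mapsto\{\phi^{-1}(U):U\in\mathcal U\}$; this is a contravariant functor. $h_{top}(\phi)=\sup_{\mathcal U\in\mathfrak{cov}(X)}\lim_n\frac1n\log N(\mathcal U\vee\phi^{-1}(\mathcal U)\vee\dots\vee\phi^{-n+1}(\mathcal U))$. *)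

theory Defs
  imports "HOL-Analysis.Analysis"
begin

text \<open>
  All categories below are concrete: an object has an underlying set in a type, and the arrows
  are extensional functions (\<open>undefined\<close> outside the underlying set of the source), composed with
  \<^const>\<open>compose\<close> of \<^theory>\<open>HOL-Library.FuncSet\<close>. In this way two arrows
  with the same source and target are equal as soon as they agree on the underlying set.
\<close>

record ('o, 'a) concrete_cat =
  Obj :: "'o set"
  Und :: "'o \<Rightarrow> 'a set"
  Hom :: "'o \<Rightarrow> 'o \<Rightarrow> ('a \<Rightarrow> 'a) set"

definition concrete_category :: "('o, 'a) concrete_cat \<Rightarrow> bool" where
  "concrete_category C \<longleftrightarrow>
     (\<forall>X\<in>Obj C. \<forall>Y\<in>Obj C. Hom C X Y \<subseteq> Und C X \<rightarrow>\<^sub>E Und C Y) \<and>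
     (\<forall>X\<in>Obj C. (\<lambda>x\<in>Und C X. x) \<in> Hom C X X) \<and>
     (\<forall>X\<in>Obj C. \<forall>Y\<in>Obj C. \<forall>Z\<in>Obj C. \<forall>f\<in>Hom C X Y. \<forall>g\<in>Hom C Y Z.
        compose (Und C X) g f \<in> Hom C X Z)"

text \<open>
  An extensional function does not determine its source and target, so the arrow part of a
  functor takes them as arguments: \<open>Ar F X Y f\<close> is the image of \<open>f : X \<rightarrow> Y\<close>, for a covariant as
  well as for a contravariant functor.
\<close>

record ('o1, 'a, 'o2, 'b) functor_data =
  Ob :: "'o1 \<Rightarrow> 'o2"
  Ar :: "'o1 \<Rightarrow> 'o1 \<Rightarrow> ('a \<Rightarrow> 'a) \<Rightarrow> ('b \<Rightarrow> 'b)"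

definition covariant_functor ::
    "('o1, 'a) concrete_cat \<Rightarrow> ('o2, 'b) concrete_cat \<Rightarrow> ('o1, 'a, 'o2, 'b) functor_data \<Rightarrow> bool" where
  "covariant_functor C D F \<longleftrightarrow>
     (\<forall>X\<in>Obj C. Ob F X \<in> Obj D) \<and>
     (\<forall>X\<in>Obj C. \<forall>Y\<in>Obj C. \<forall>f\<in>Hom C X Y. Ar F X Y f \<in> Hom D (Ob F X) (Ob F Y)) \<and>
     (\<forall>X\<in>Obj C. Ar F X X (\<lambda>x\<in>Und C X. x) = (\<lambda>x\<in>Und D (Ob F X). x)) \<and>
     (\<forall>X\<in>Obj C. \<forall>Y\<in>Obj C. \<forall>Z\<in>Obj C. \<forall>f\<in>Hom C X Y. \<forall>g\<in>Hom C Y Z.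
        Ar F X Z (compose (Und C X) g f) = compose (Und D (Ob F X)) (Ar F Y Z g) (Ar F X Y f))"

definition contravariant_functor ::
    "('o1, 'a) concrete_cat \<Rightarrow> ('o2, 'b) concrete_cat \<Rightarrow> ('o1, 'a, 'o2, 'b) functor_data \<Rightarrow> bool" where
  "contravariant_functor C D F \<longleftrightarrow>
     (\<forall>X\<in>Obj C. Ob F X \<in> Obj D) \<and>
     (\<forall>X\<in>Obj C. \<forall>Y\<in>Obj C. \<forall>f\<in>Hom C X Y. Ar F X Y f \<in> Hom D (Ob F Y) (Ob F X)) \<and>
     (\<forall>X\<in>Obj C. Ar F X X (\<lambda>x\<in>Und C X. x) = (\<lambda>x\<in>Und D (Ob F X). x)) \<and>
     (\<forall>X\<in>Obj C. \<forall>Y\<in>Obj C. \<forall>Z\<in>Obj C. \<forall>f\<in>Hom C X Y. \<forall>g\<in>Hom C Y Z.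
        Ar F X Z (compose (Und C X) g f) = compose (Und D (Ob F Z)) (Ar F X Y f) (Ar F Y Z g))"

text \<open>The (covariant) composite of two contravariant functors, the second argument applied first.\<close>

definition comp_contra ::
    "('o2, 'b, 'o3, 'c) functor_data \<Rightarrow> ('o1, 'a, 'o2, 'b) functor_data \<Rightarrow> ('o1, 'a, 'o3, 'c) functor_data" where
  "comp_contra G F =
     \<lparr>Ob = (\<lambda>X. Ob G (Ob F X)), Ar = (\<lambda>X Y f. Ar G (Ob F Y) (Ob F X) (Ar F X Y f))\<rparr>"

definition is_product ::
    "('o, 'a) concrete_cat \<Rightarrow> 'i set \<Rightarrow> ('i \<Rightarrow> 'o) \<Rightarrow> 'o \<Rightarrow> ('i \<Rightarrow> 'a \<Rightarrow> 'a) \<Rightarrow> bool" where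
  "is_product C I A P p \<longleftrightarrow>
     P \<in> Obj C \<and> (\<forall>i\<in>I. A i \<in> Obj C \<and> p i \<in> Hom C P (A i)) \<and>
     (\<forall>T\<in>Obj C. \<forall>f. (\<forall>i\<in>I. f i \<in> Hom C T (A i)) \<longrightarrow>
        (\<exists>!g. g \<in> Hom C T P \<and> (\<forall>i\<in>I. compose (Und C T) (p i) g = f i)))"


text \<open>
  The type \<open>'a\<close> plays the role of the universe: the objects of \<open>Set_cat\<close> are the sets of
  elements of \<open>'a\<close>, and small families are those indexed by such sets.
\<close>

definition Set_cat :: "('a set, 'a) concrete_cat" where
  "Set_cat = \<lparr>Obj = UNIV, Und = (\<lambda>X. X), Hom = (\<lambda>X Y. X \<rightarrow>\<^sub>E Y)\<rparr>"

definition CTop2 :: "('b topology, 'b) concrete_cat" where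
  "CTop2 =
     \<lparr>Obj = {X. compact_space X \<and> Hausdorff_space X}, Und = topspace,
      Hom = (\<lambda>X Y. {f \<in> extensional (topspace X). continuous_map X Y f})\<rparr>"

text \<open>
  \<open>X\<close> is the disjoint union of the \<open>A i\<close>, with canonical maps \<open>\<iota> i : A i \<rightarrow> X\<close>. Up to the given
  bijection, this is the set of pairs \<open>(i, x)\<close> with \<open>i \<in> I\<close> and \<open>x \<in> A i\<close>.
\<close>

definition is_set_coproduct ::
    "'i set \<Rightarrow> ('i \<Rightarrow> 'a set) \<Rightarrow> 'a set \<Rightarrow> ('i \<Rightarrow> 'a \<Rightarrow> 'a) \<Rightarrow> bool" where
  "is_set_coproduct I A X \<iota> \<longleftrightarrow>
     (\<forall>i\<in>I. \<iota> i \<in> A i \<rightarrow>\<^sub>E X) \<and> bij_betw (\<lambda>(i, x). \<iota> i x) (Sigma I A) X"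

definition coproducts_to_products :: "('a set, 'a, 'b topology, 'b) functor_data \<Rightarrow> bool" where
  "coproducts_to_products \<epsilon> \<longleftrightarrow>
     (\<forall>(I :: 'a set) A X \<iota>. is_set_coproduct I A X \<iota> \<longrightarrow>
        is_product CTop2 I (\<lambda>i. Ob \<epsilon> (A i)) (Ob \<epsilon> X) (\<lambda>i. Ar \<epsilon> (A i) X (\<iota> i)))"


record 'c normed_sgp =
  car :: "'c set"
  mul :: "'c \<Rightarrow> 'c \<Rightarrow> 'c"
  nrm :: "'c \<Rightarrow> real"
  leq :: "'c \<Rightarrow> 'c \<Rightarrow> bool"

definition normed_preordered_semigroup :: "'c normed_sgp \<Rightarrow> bool" where
  "normed_preordered_semigroup S \<longleftrightarrow>
     (\<forall>x\<in>car S. \<forall>y\<in>car S. mul S x y \<in> car S) \<and>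
     (\<forall>x\<in>car S. \<forall>y\<in>car S. \<forall>z\<in>car S. mul S (mul S x y) z = mul S x (mul S y z)) \<and>
     (\<forall>x\<in>car S. 0 \<le> nrm S x) \<and>
     (\<forall>x\<in>car S. leq S x x) \<and>
     (\<forall>x\<in>car S. \<forall>y\<in>car S. \<forall>z\<in>car S. leq S x y \<longrightarrow> leq S y z \<longrightarrow> leq S x z)"

definition sgp_hom :: "'c normed_sgp \<Rightarrow> 'd normed_sgp \<Rightarrow> ('c \<Rightarrow> 'd) set" where
  "sgp_hom S T =
     {f \<in> car S \<rightarrow>\<^sub>E car T. \<forall>x\<in>car S. \<forall>y\<in>car S. f (mul S x y) = mul T (f x) (f y)}"

text \<open>The category \<open>\<SS>\<close> of contractive homomorphisms; in \<open>\<SS>*\<close> the arrows are all of \<^const>\<open>sgp_hom\<close>.\<close>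

definition Sgp_cat :: "('c normed_sgp, 'c) concrete_cat" where
  "Sgp_cat =
     \<lparr>Obj = {S. normed_preordered_semigroup S}, Und = car,
      Hom = (\<lambda>S T. {f \<in> sgp_hom S T. \<forall>x\<in>car S. nrm T (f x) \<le> nrm S x})\<rparr>"

text \<open>
  The product \<open>x \<cdot> \<phi>(x) \<cdots> \<phi>\<^sup>n\<^sup>-\<^sup>1(x)\<close> for \<open>n \<ge> 1\<close>. There need not be a neutral element; the value
  at \<open>n = 0\<close> is \<open>x\<close> and is irrelevant for the entropy.
\<close>

definition sgp_traj :: "'c normed_sgp \<Rightarrow> ('c \<Rightarrow> 'c) \<Rightarrow> 'c \<Rightarrow> nat \<Rightarrow> 'c" where
  "sgp_traj S \<phi> x n = foldl (mul S) x (map (\<lambda>i. (\<phi> ^^ i) x) [1..<n])"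

definition sgp_entropy :: "'c normed_sgp \<Rightarrow> ('c \<Rightarrow> 'c) \<Rightarrow> ereal" where
  "sgp_entropy S \<phi> = (SUP x\<in>car S. limsup (\<lambda>n. ereal (nrm S (sgp_traj S \<phi> x n) / real n)))"

definition functor_entropy ::
    "('o, 'a, 'c normed_sgp, 'c) functor_data \<Rightarrow> 'o \<Rightarrow> ('a \<Rightarrow> 'a) \<Rightarrow> ereal" where
  "functor_entropy F X \<phi> = sgp_entropy (Ob F X) (Ar F X X \<phi>)"

definition weak_isomorphism :: "real \<Rightarrow> 'c normed_sgp \<Rightarrow> 'd normed_sgp \<Rightarrow> ('c \<Rightarrow> 'd) \<Rightarrow> bool" where
  "weak_isomorphism r S T \<alpha> \<longleftrightarrow>
     0 < r \<and> \<alpha> \<in> sgp_hom S T \<and> inj_on \<alpha> (car S) \<and>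
     (\<forall>x\<in>car S. nrm T (\<alpha> x) = r * nrm S x) \<and>
     (\<forall>t\<in>car T. \<exists>s\<in>car S. leq T t (\<alpha> s))"

text \<open>
  Natural transformations, in \<open>\<SS>*\<close>, between covariant functors. The semigroups may have their
  elements in two different types.
\<close>

definition sgp_nat_trans ::
    "('o, 'a) concrete_cat \<Rightarrow> ('o, 'a, 'c normed_sgp, 'c) functor_data \<Rightarrow>
     ('o, 'a, 'd normed_sgp, 'd) functor_data \<Rightarrow> ('o \<Rightarrow> 'c \<Rightarrow> 'd) \<Rightarrow> bool" where
  "sgp_nat_trans C F G \<eta> \<longleftrightarrow>
     (\<forall>X\<in>Obj C. \<eta> X \<in> sgp_hom (Ob F X) (Ob G X)) \<and>
     (\<forall>X\<in>Obj C. \<forall>Y\<in>Obj C. \<forall>f\<in>Hom C X Y.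
        compose (car (Ob F X)) (\<eta> Y) (Ar F X Y f) = compose (car (Ob F X)) (Ar G X Y f) (\<eta> X))"

text \<open>
  \<open>SBT\<^sup>w\<close> for the entropies of \<open>F\<^sub>1\<close> and \<open>F\<^sub>2\<close>, in the case where \<open>F\<^sub>1\<close> is covariant and both \<open>F\<^sub>2\<close>
  and \<open>\<epsilon>\<close> are contravariant.
\<close>

definition SBT_weak ::
    "('o1, 'a) concrete_cat \<Rightarrow> ('o1, 'a, 'o2, 'b) functor_data \<Rightarrow> real \<Rightarrow>
     ('o1, 'a, 'c normed_sgp, 'c) functor_data \<Rightarrow> ('o2, 'b, 'd normed_sgp, 'd) functor_data \<Rightarrow> bool" where
  "SBT_weak X1 \<epsilon> C F1 F2 \<longleftrightarrow>
     0 < C \<and>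
     (\<exists>\<eta>. sgp_nat_trans X1 F1 (comp_contra F2 \<epsilon>) \<eta> \<and>
          (\<forall>X\<in>Obj X1. weak_isomorphism C (Ob F1 X) (Ob (comp_contra F2 \<epsilon>) X) (\<eta> X)))"

text \<open>The product of \<^typ>\<open>ereal\<close> satisfies \<open>\<infinity> * 0 = 0\<close>.\<close>

definition BT ::
    "('o1, 'a) concrete_cat \<Rightarrow> ('o1, 'a, 'o2, 'b) functor_data \<Rightarrow> ereal \<Rightarrow>
     ('o1 \<Rightarrow> ('a \<Rightarrow> 'a) \<Rightarrow> ereal) \<Rightarrow> ('o2 \<Rightarrow> ('b \<Rightarrow> 'b) \<Rightarrow> ereal) \<Rightarrow> bool" where
  "BT X1 \<epsilon> C h1 h2 \<longleftrightarrow>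
     0 < C \<and> (\<forall>X\<in>Obj X1. \<forall>\<phi>\<in>Hom X1 X X. h2 (Ob \<epsilon> X) (Ar \<epsilon> X X \<phi>) = C * h1 X \<phi>)"


definition set_entropy :: "'a set \<Rightarrow> ('a \<Rightarrow> 'a) \<Rightarrow> ereal" where
  "set_entropy X f =
     (SUP D\<in>{D. finite D \<and> D \<subseteq> X}. lim (\<lambda>n. ereal (real (card (\<Union>i<n. (f ^^ i) ` D)) / real n)))"

definition im_functor :: "('a set, 'a, 'a set normed_sgp, 'a set) functor_data" where
  "im_functor =
     \<lparr>Ob = (\<lambda>X. \<lparr>car = {D. finite D \<and> D \<subseteq> X}, mul = (\<union>),
                 nrm = (\<lambda>D. real (card D)), leq = (\<subseteq>)\<rparr>),
      Ar = (\<lambda>X Y f. \<lambda>D\<in>{D. finite D \<and> D \<subseteq> X}. f ` D)\<rparr>"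


definition open_covers :: "'b topology \<Rightarrow> 'b set set set" where
  "open_covers X = {\<U>. (\<forall>U\<in>\<U>. openin X U) \<and> \<Union>\<U> = topspace X}"

definition cover_join :: "'b set set \<Rightarrow> 'b set set \<Rightarrow> 'b set set" where
  "cover_join \<U> \<V> = {U \<inter> V | U V. U \<in> \<U> \<and> V \<in> \<V>}"

definition cover_number :: "'b topology \<Rightarrow> 'b set set \<Rightarrow> nat" where
  "cover_number X \<U> = (LEAST n. \<exists>\<V>\<subseteq>\<U>. finite \<V> \<and> \<Union>\<V> = topspace X \<and> card \<V> = n)"

definition cover_pullback :: "'b topology \<Rightarrow> ('b \<Rightarrow> 'b) \<Rightarrow> 'b set set \<Rightarrow> 'b set set" where
  "cover_pullback X f \<U> = (\<lambda>U. f -` U \<inter> topspace X) ` \<U>"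

text \<open>On the empty space \<^const>\<open>cover_number\<close> is \<open>0\<close>, and the norm is then \<open>ln 0 = 0\<close>.\<close>

definition cov_functor :: "('b topology, 'b, 'b set set normed_sgp, 'b set set) functor_data" where
  "cov_functor =
     \<lparr>Ob = (\<lambda>X. \<lparr>car = open_covers X, mul = cover_join,
                 nrm = (\<lambda>\<U>. ln (real (cover_number X \<U>))),
                 leq = (\<lambda>\<U> \<V>. \<forall>V\<in>\<V>. \<exists>U\<in>\<U>. V \<subseteq> U)\<rparr>),
      Ar = (\<lambda>X Y f. \<lambda>\<U>\<in>open_covers Y. cover_pullback X f \<U>)\<rparr>"

definition top_entropy :: "'b topology \<Rightarrow> ('b \<Rightarrow> 'b) \<Rightarrow> ereal" where
  "top_entropy X f =
     (SUP \<U>\<in>open_covers X. lim (\<lambda>n. ereal (1 / real n *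
        ln (real (cover_number X
          (foldl cover_join \<U> (map (\<lambda>i. cover_pullback X (f ^^ i) \<U>) [1..<n])))))))"


lemma concrete_category_Set_cat: "concrete_category Set_cat"
  unfolding concrete_category_def Set_cat_def by (auto simp: compose_def)

lemma CTop2_Hom_PiE: "f \<in> Hom CTop2 X Y \<Longrightarrow> f \<in> topspace X \<rightarrow>\<^sub>E topspace Y"
  using continuous_map_funspace[of X Y f] by (auto simp: CTop2_def PiE_def)

lemma CTop2_id: "(\<lambda>x\<in>topspace X. x) \<in> Hom CTop2 X X"
proof -
  have "continuous_map X X (\<lambda>x\<in>topspace X. x)"
    by (rule continuous_map_eq[OF continuous_map_id]) simp
  then show ?thesis by (simp add: CTop2_def)
qed

lemma CTop2_compose:
  assumes "f \<in> Hom CTop2 X Y" "g \<in> Hom CTop2 Y Z"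
  shows "compose (topspace X) g f \<in> Hom CTop2 X Z"
proof -
  have "continuous_map X Z (g \<circ> f)"
    using assms continuous_map_compose by (fastforce simp: CTop2_def)
  then have "continuous_map X Z (compose (topspace X) g f)"
    by (rule continuous_map_eq) (simp add: compose_def)
  then show ?thesis by (simp add: CTop2_def)
qed

lemma concrete_category_CTop2: "concrete_category (CTop2 :: ('b topology, 'b) concrete_cat)"
proof -
  have "Und CTop2 = (topspace :: 'b topology \<Rightarrow> _)" by (simp add: CTop2_def)
  then show ?thesis
    unfolding concrete_category_def by (simp add: CTop2_id CTop2_compose subsetI CTop2_Hom_PiE)
qed

lemma sgp_hom_compose:
  assumes S: "normed_preordered_semigroup S" and f: "f \<in> sgp_hom S T" and g: "g \<in> sgp_hom T U"
  shows "compose (car S) g f \<in> sgp_hom S U"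
proof -
  have mul: "mul S x y \<in> car S" if "x \<in> car S" "y \<in> car S" for x y
    using S that unfolding normed_preordered_semigroup_def by blast
  have f1: "f x \<in> car T" if "x \<in> car S" for x
    using f that by (auto simp: sgp_hom_def)
  have f2: "f (mul S x y) = mul T (f x) (f y)" if "x \<in> car S" "y \<in> car S" for x y
    using f that by (simp add: sgp_hom_def)
  have g1: "g x \<in> car U" if "x \<in> car T" for x
    using g that by (auto simp: sgp_hom_def)
  have g2: "g (mul T x y) = mul U (g x) (g y)" if "x \<in> car T" "y \<in> car T" for x y
    using g that by (simp add: sgp_hom_def)
  show ?thesis
    unfolding sgp_hom_def by (simp add: compose_def mul f1 f2 g1 g2)
qed

lemma concrete_category_Sgp_cat: "concrete_category (Sgp_cat :: ('c normed_sgp, 'c) concrete_cat)"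
proof -
  have U: "Und Sgp_cat = (car :: 'c normed_sgp \<Rightarrow> _)" by (simp add: Sgp_cat_def)
  have 1: "Hom Sgp_cat S T \<subseteq> car S \<rightarrow>\<^sub>E car T" for S T :: "'c normed_sgp"
    by (auto simp: Sgp_cat_def sgp_hom_def)
  have 2: "(\<lambda>x\<in>car S. x) \<in> Hom Sgp_cat S S" if "S \<in> Obj Sgp_cat" for S :: "'c normed_sgp"
    using that unfolding Sgp_cat_def sgp_hom_def normed_preordered_semigroup_def by simp
  have 3: "compose (car S) g f \<in> Hom Sgp_cat S U"
    if "S \<in> Obj Sgp_cat" and f: "f \<in> Hom Sgp_cat S T" and g: "g \<in> Hom Sgp_cat T U"
    for S T U :: "'c normed_sgp" and f g
  proof -
    have "nrm U (g (f x)) \<le> nrm S x" if x: "x \<in> car S" for x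
    proof -
      have "f x \<in> car T" "nrm T (f x) \<le> nrm S x"
        using x f by (auto simp: Sgp_cat_def sgp_hom_def)
      moreover from this(1) have "nrm U (g (f x)) \<le> nrm T (f x)"
        using g by (auto simp: Sgp_cat_def)
      ultimately show ?thesis by linarith
    qed
    moreover have "compose (car S) g f \<in> sgp_hom S U"
      using that by (intro sgp_hom_compose[where T = T]) (auto simp: Sgp_cat_def)
    ultimately show ?thesis
      by (simp add: Sgp_cat_def compose_def)
  qed
  from 1 2 3 show ?thesis
    unfolding concrete_category_def U by blast
qed

lemma covariant_im_functor:
  "covariant_functor (Set_cat :: ('a set, 'a) concrete_cat) Sgp_cat im_functor"
proof -
  let ?I = "im_functor :: ('a set, 'a, 'a set normed_sgp, 'a set) functor_data"
  have car: "car (Ob ?I X) = {D. finite D \<and> D \<subseteq> X}" for X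
    by (simp add: im_functor_def)
  have Ar: "Ar ?I X Y f = (\<lambda>D\<in>{D. finite D \<and> D \<subseteq> X}. f ` D)" for X Y f
    by (simp add: im_functor_def)
  have 1: "Ob ?I X \<in> Obj Sgp_cat" for X
    by (auto simp: Sgp_cat_def im_functor_def normed_preordered_semigroup_def)
  have 2: "Ar ?I X Y f \<in> Hom Sgp_cat (Ob ?I X) (Ob ?I Y)" if "f \<in> X \<rightarrow>\<^sub>E Y" for X Y f
    using that by (auto simp: Sgp_cat_def im_functor_def sgp_hom_def card_image_le)
  have 3: "Ar ?I X X (\<lambda>x\<in>X. x) = (\<lambda>D\<in>car (Ob ?I X). D)" for X
    unfolding Ar car by (intro restrict_ext) (auto simp: restrict_def image_def)
  have 4: "Ar ?I X Z (compose X g f) = compose (car (Ob ?I X)) (Ar ?I Y Z g) (Ar ?I X Y f)"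
    if "f \<in> X \<rightarrow>\<^sub>E Y" for X Y Z f g
  proof -
    have "compose X g f ` D = g ` f ` D" if "D \<subseteq> X" for D
      unfolding image_image by (rule image_cong[OF refl]) (use that in \<open>auto simp: compose_def\<close>)
    moreover have "f ` D \<subseteq> Y" if "D \<subseteq> X" for D
      using that \<open>f \<in> X \<rightarrow>\<^sub>E Y\<close> by auto
    ultimately show ?thesis
      unfolding Ar car compose_def[of "{D. finite D \<and> D \<subseteq> X}"] by (intro restrict_ext) simp
  qed
  have "Und Sgp_cat = (car :: 'a set normed_sgp \<Rightarrow> _)" by (simp add: Sgp_cat_def)
  then show ?thesis
    unfolding covariant_functor_def by (simp add: Set_cat_def 1 2 3 4)
qed

lemma cover_number_witness:
  assumes "compact_space X" "\<U> \<in> open_covers X"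
  obtains \<V> where "\<V> \<subseteq> \<U>" "finite \<V>" "\<Union>\<V> = topspace X" "card \<V> = cover_number X \<U>"
proof -
  have "(\<forall>U\<in>\<U>. openin X U) \<and> topspace X \<subseteq> \<Union>\<U>"
    using assms(2) by (simp add: open_covers_def)
  with assms(1) have "\<exists>\<W>. finite \<W> \<and> \<W> \<subseteq> \<U> \<and> topspace X \<subseteq> \<Union>\<W>"
    unfolding compact_space_alt by simp
  then obtain \<W> where \<W>: "finite \<W>" "\<W> \<subseteq> \<U>" "topspace X \<subseteq> \<Union>\<W>"
    by blast
  moreover have "\<Union>\<W> \<subseteq> topspace X"
    using \<W>(2) assms(2) by (auto simp: open_covers_def)
  ultimately have "\<exists>n. \<exists>\<V>\<subseteq>\<U>. finite \<V> \<and> \<Union>\<V> = topspace X \<and> card \<V> = n"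
    by blast
  from LeastI_ex[OF this] show thesis
    using that unfolding cover_number_def by blast
qed

lemma cover_number_le:
  assumes "\<V> \<subseteq> \<U>" "finite \<V>" "\<Union>\<V> = topspace X"
  shows "cover_number X \<U> \<le> card \<V>"
  unfolding cover_number_def using assms by (intro Least_le) blast

lemma cover_pullback_open_covers:
  assumes "continuous_map X Y f" "\<U> \<in> open_covers Y"
  shows "cover_pullback X f \<U> \<in> open_covers X"
proof -
  have "openin X (f -` U \<inter> topspace X)" if "U \<in> \<U>" for U
    using assms that openin_continuous_map_preimage[of X Y f U]
    by (auto simp: open_covers_def vimage_def Int_def conj_commute)
  moreover have "(\<Union>U\<in>\<U>. f -` U \<inter> topspace X) = topspace X"
    using assms continuous_map_funspace[OF assms(1)] by (fastforce simp: open_covers_def)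
  ultimately show ?thesis
    by (auto simp: open_covers_def cover_pullback_def)
qed

lemma cover_number_pullback_le:
  assumes f: "continuous_map X Y f" and "compact_space Y" and \<U>: "\<U> \<in> open_covers Y"
  shows "cover_number X (cover_pullback X f \<U>) \<le> cover_number Y \<U>"
proof -
  obtain \<V> where \<V>: "\<V> \<subseteq> \<U>" "finite \<V>" "\<Union>\<V> = topspace Y" "card \<V> = cover_number Y \<U>"
    by (rule cover_number_witness[OF assms(2) \<U>])
  have "\<V> \<in> open_covers Y" using \<V> \<U> by (auto simp: open_covers_def)
  then have "\<Union>(cover_pullback X f \<V>) = topspace X"
    using cover_pullback_open_covers[OF f] by (simp add: open_covers_def)
  then have "cover_number X (cover_pullback X f \<U>) \<le> card (cover_pullback X f \<V>)"
    using \<V> by (intro cover_number_le) (auto simp: cover_pullback_def)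
  also have "\<dots> \<le> card \<V>" unfolding cover_pullback_def by (rule card_image_le[OF \<V>(2)])
  finally show ?thesis using \<V>(4) by simp
qed

lemma cover_join_open_covers:
  assumes "\<U> \<in> open_covers X" "\<V> \<in> open_covers X"
  shows "cover_join \<U> \<V> \<in> open_covers X"
proof -
  have "\<Union>(cover_join \<U> \<V>) = \<Union>\<U> \<inter> \<Union>\<V>"
    unfolding cover_join_def by blast
  then show ?thesis
    using assms by (auto simp: open_covers_def cover_join_def)
qed

lemma cover_join_assoc: "cover_join (cover_join \<U> \<V>) \<W> = cover_join \<U> (cover_join \<V> \<W>)"
proof -
  have "cover_join (cover_join \<U> \<V>) \<W> = {U \<inter> V \<inter> W | U V W. U \<in> \<U> \<and> V \<in> \<V> \<and> W \<in> \<W>}"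
    unfolding cover_join_def by blast
  also have "\<dots> = {U \<inter> (V \<inter> W) | U V W. U \<in> \<U> \<and> V \<in> \<V> \<and> W \<in> \<W>}"
    unfolding Int_assoc ..
  also have "\<dots> = cover_join \<U> (cover_join \<V> \<W>)"
    unfolding cover_join_def by blast
  finally show ?thesis .
qed

lemma cover_pullback_join:
  "cover_pullback X f (cover_join \<U> \<V>) = cover_join (cover_pullback X f \<U>) (cover_pullback X f \<V>)"
proof -
  let ?p = "\<lambda>U. f -` U \<inter> topspace X"
  have "cover_pullback X f (cover_join \<U> \<V>) = {?p (U \<inter> V) | U V. U \<in> \<U> \<and> V \<in> \<V>}"
    unfolding cover_pullback_def cover_join_def by blast
  also have "\<dots> = {?p U \<inter> ?p V | U V. U \<in> \<U> \<and> V \<in> \<V>}"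
  proof -
    have "?p (U \<inter> V) = ?p U \<inter> ?p V" for U V by blast
    then show ?thesis by simp
  qed
  also have "\<dots> = cover_join (cover_pullback X f \<U>) (cover_pullback X f \<V>)"
    unfolding cover_pullback_def cover_join_def by blast
  finally show ?thesis .
qed

lemma contravariant_cov_functor:
  "contravariant_functor (CTop2 :: ('b topology, 'b) concrete_cat) Sgp_cat cov_functor"
proof -
  let ?c = "cov_functor :: ('b topology, 'b, 'b set set normed_sgp, 'b set set) functor_data"
  have car: "car (Ob ?c X) = open_covers X" for X
    by (simp add: cov_functor_def)
  have Ar: "Ar ?c X Y f = (\<lambda>\<U>\<in>open_covers Y. cover_pullback X f \<U>)" for X Y f
    by (simp add: cov_functor_def)
  have ln: "ln (real m) \<le> ln (real n)" if "m \<le> n" for m n :: nat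
    using that by (cases "m = 0"; cases "n = 0") auto
  have 1: "Ob ?c X \<in> Obj Sgp_cat" for X
  proof -
    have "0 \<le> ln (real n)" for n :: nat by (cases "n = 0") auto
    then show ?thesis
      unfolding Sgp_cat_def normed_preordered_semigroup_def
      by (simp add: cov_functor_def cover_join_open_covers cover_join_assoc) (meson order_refl order_trans)
  qed
  have 2: "Ar ?c X Y f \<in> Hom Sgp_cat (Ob ?c Y) (Ob ?c X)"
    if "compact_space Y" "continuous_map X Y f" for X Y f
    using that
    by (simp add: Sgp_cat_def sgp_hom_def cov_functor_def cover_pullback_open_covers
        cover_join_open_covers cover_pullback_join cover_number_pullback_le ln)
  have 3: "Ar ?c X X (\<lambda>x\<in>topspace X. x) = (\<lambda>\<U>\<in>car (Ob ?c X). \<U>)" for X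
  proof -
    have "(\<lambda>x\<in>topspace X. x) -` U \<inter> topspace X = U" if "\<U> \<in> open_covers X" "U \<in> \<U>" for \<U> U
      using that by (auto simp: open_covers_def)
    then show ?thesis
      unfolding Ar car by (intro restrict_ext) (simp add: cover_pullback_def)
  qed
  have 4: "Ar ?c X Z (compose (topspace X) g f) = compose (car (Ob ?c Z)) (Ar ?c X Y f) (Ar ?c Y Z g)"
    if f: "continuous_map X Y f" and g: "continuous_map Y Z g" for X Y Z f g
  proof -
    have "compose (topspace X) g f -` U \<inter> topspace X = f -` (g -` U \<inter> topspace Y) \<inter> topspace X" for U
      using continuous_map_funspace[OF f] by (auto simp: compose_def)
    then show ?thesis
      unfolding Ar car compose_def[of "open_covers Z"]
      by (intro restrict_ext)
        (simp add: cover_pullback_open_covers[OF g] image_image, simp add: cover_pullback_def image_image)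
  qed
  have "Und Sgp_cat = (car :: 'b set set normed_sgp \<Rightarrow> _)" by (simp add: Sgp_cat_def)
  then show ?thesis
    unfolding contravariant_functor_def by (simp add: CTop2_def 1 2 3 4)
qed

end

theory Submission imports Defs begin

text \<open>
  A set \<open>X\<close> is the coproduct of its points, so \<open>\<epsilon> X\<close> is the power \<open>K\<^sup>X\<close> and \<open>\<epsilon> \<phi>\<close> is the generalised
  shift \<open>k \<mapsto> k \<circ> \<phi>\<close>. If \<open>K\<close> is finite, the cylinders over the finite sets \<open>D\<close> form covers with
  \<open>card K ^ card D\<close> indispensable members, natural in \<open>D\<close> and cofinal among all open covers; this gives the
  weak isomorphism and the entropy formula. If \<open>K\<close> is infinite, covers of \<open>K\<close> separating \<open>m\<close> points
  force \<open>h_top(\<epsilon> \<phi>) \<ge> r ln m\<close> for all \<open>m\<close> as soon as some finite \<open>D\<close> has a trajectory growing at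
  rate \<open>r > 0\<close>. Otherwise every finite \<open>D\<close> has a finite trajectory, so the pullbacks of a finite
  cover by boxes over \<open>D\<close> are finite in number, and the cover numbers of its trajectory are bounded.
\<close>

section \<open>Subadditive sequences and trajectories of finite sets\<close>

text \<open>Fekete's lemma: the averages converge to their infimum over positive indices.
  Subadditivity is asked for positive indices only, because cover trajectories do not split
  additively at index 0.\<close>

lemma subadditive_imp_convergent_average:
  fixes a :: "nat \<Rightarrow> real"
  assumes sub: "\<And>m n. 0 < m \<Longrightarrow> 0 < n \<Longrightarrow> a (m + n) \<le> a m + a n"
    and nonneg: "\<And>n. 0 \<le> a n"
  shows "convergent (\<lambda>n. a n / real n)"
proof -
  define L where "L = (INF n\<in>{0<..}. a n / real n)"
  have bdd: "bdd_below ((\<lambda>n. a n / real n) ` {0<..})"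
    using nonneg by (intro bdd_belowI[where m = 0]) auto
  have low: "L \<le> a n / real n" if "0 < n" for n
    unfolding L_def using that by (intro cINF_lower[OF bdd]) auto
  have "(\<lambda>n. a n / real n) \<longlonglongrightarrow> L"
  proof (rule LIMSEQ_I)
    fix e :: real assume e: "0 < e"
    have "\<exists>m\<in>{0<..}. a m / real m < L + e / 2"
      using e unfolding L_def by (subst cINF_less_iff[symmetric, OF _ bdd]) auto
    then obtain m where m: "0 < m" "a m / real m < L + e / 2" by auto
    \<comment> \<open>\<open>M\<close> dominates every \<open>a n\<close> with \<open>n\<close> at
      most \<open>m\<close>, so it absorbs the remainder left after splitting off blocks of length
      \<open>m\<close>.\<close>
    define M where "M = (\<Sum>r\<le>m. a r)"
    have M: "a n \<le> real n * (a m / real m) + M" if "0 < n" for n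
      using that
    proof (induction n rule: less_induct)
      case (less n)
      show ?case
      proof (cases "n \<le> m")
        case True
        have "a n \<le> M"
          unfolding M_def using True nonneg by (intro member_le_sum) auto
        moreover have "0 \<le> real n * (a m / real m)" using nonneg[of m] by simp
        ultimately show ?thesis by linarith
      next
        case False
        have "a n = a (m + (n - m))" using False by simp
        also have "\<dots> \<le> a m + a (n - m)" using False m(1) by (intro sub) auto
        also have "\<dots> \<le> a m + (real (n - m) * (a m / real m) + M)"
          using False m(1) by (intro add_left_mono less.IH) auto
        also have "\<dots> = real n * (a m / real m) + M"
          using False m(1) by (simp add: of_nat_diff field_simps)
        finally show ?thesis .
      qed
    qed
    obtain N where N: "M < real N * (e / 2)"
      using ex_less_of_nat_mult[of "e / 2" M] e by auto
    show "\<exists>N. \<forall>n\<ge>N. norm (a n / real n - L) < e"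
    proof (intro exI[of _ "Suc N"] allI impI)
      fix n assume n: "Suc N \<le> n"
      then have "0 < n" by simp
      have "real N * (e / 2) \<le> real n * (e / 2)" using n e by (intro mult_right_mono) auto
      then have "M < real n * (e / 2)" using N by linarith
      moreover have "real n * (a m / real m) < real n * (L + e / 2)"
        using m(2) \<open>0 < n\<close> by (intro mult_strict_left_mono) auto
      ultimately have "a n < real n * (L + e / 2) + real n * (e / 2)"
        using M[OF \<open>0 < n\<close>] by linarith
      also have "\<dots> = (L + e) * real n" by (simp add: algebra_simps)
      finally have "a n / real n < L + e" using \<open>0 < n\<close> by (simp add: pos_divide_less_eq)
      then show "norm (a n / real n - L) < e"
        using low[OF \<open>0 < n\<close>] e by (simp add: abs_if)
    qed
  qed
  then show ?thesis by (rule convergentI)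
qed

section \<open>Growth of the orbits of finite sets\<close>

definition set_traj :: "('a \<Rightarrow> 'a) \<Rightarrow> 'a set \<Rightarrow> nat \<Rightarrow> 'a set" where
  "set_traj f D n = (\<Union>i<n. (f ^^ i) ` D)"

lemma set_traj_1: "set_traj f D (Suc 0) = D"
  by (simp add: set_traj_def lessThan_Suc)

lemma set_traj_Suc: "set_traj f D (Suc n) = set_traj f D n \<union> (f ^^ n) ` D"
  unfolding set_traj_def lessThan_Suc by auto

lemma finite_set_traj: "finite D \<Longrightarrow> finite (set_traj f D n)"
  by (simp add: set_traj_def)

lemma funpow_PiE_mem: "f \<in> X \<rightarrow>\<^sub>E X \<Longrightarrow> x \<in> X \<Longrightarrow> (f ^^ i) x \<in> X"
  by (induction i) auto

lemma set_traj_subset: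
  assumes "f \<in> X \<rightarrow>\<^sub>E X" "D \<subseteq> X"
  shows "set_traj f D n \<subseteq> X"
  unfolding set_traj_def using funpow_PiE_mem[OF assms(1)] assms(2)
  by (intro UN_least image_subsetI) blast

lemma set_traj_add: "set_traj f D (m + n) = set_traj f D m \<union> (f ^^ m) ` set_traj f D n"
proof (induction n)
  case 0
  show ?case by (simp add: set_traj_def)
next
  case (Suc n)
  have "(f ^^ (m + n)) ` D = (f ^^ m) ` (f ^^ n) ` D"
    by (simp only: funpow_add image_comp)
  then show ?case
    by (simp only: add_Suc_right set_traj_Suc image_Un Suc.IH Un_assoc)
qed

text \<open>A trajectory of length \<open>m + n\<close> is one of length \<open>m\<close> together
  with an image of one of length \<open>n\<close>, and images do not increase cardinality; hence the
  cardinalities are subadditive.\<close>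

lemma set_traj_average_convergent:
  assumes "finite D"
  shows "convergent (\<lambda>n. real (card (set_traj f D n)) / real n)"
proof (rule subadditive_imp_convergent_average)
  fix m n :: nat
  have "card (set_traj f D (m + n)) \<le> card (set_traj f D m) + card ((f ^^ m) ` set_traj f D n)"
    unfolding set_traj_add by (rule card_Un_le)
  also have "\<dots> \<le> card (set_traj f D m) + card (set_traj f D n)"
    by (intro add_left_mono card_image_le finite_set_traj assms)
  finally show "real (card (set_traj f D (m + n))) \<le> real (card (set_traj f D m)) + real (card (set_traj f D n))"
    by (metis of_nat_add of_nat_mono)
qed simp

definition traj_rate :: "('a \<Rightarrow> 'a) \<Rightarrow> 'a set \<Rightarrow> real" where
  "traj_rate f D = lim (\<lambda>n. real (card (set_traj f D n)) / real n)"

lemma traj_rate_LIMSEQ: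
  "finite D \<Longrightarrow> (\<lambda>n. real (card (set_traj f D n)) / real n) \<longlonglongrightarrow> traj_rate f D"
  unfolding traj_rate_def by (intro convergent_LIMSEQ_iff[THEN iffD1] set_traj_average_convergent)

lemma traj_rate_nonneg: "finite D \<Longrightarrow> 0 \<le> traj_rate f D"
  by (rule LIMSEQ_le_const[OF traj_rate_LIMSEQ]) auto

lemma set_entropy_eq: "set_entropy X f = (SUP D\<in>{D. finite D \<and> D \<subseteq> X}. ereal (traj_rate f D))"
  unfolding set_entropy_def
proof (rule SUP_cong[OF refl])
  fix D assume "D \<in> {D. finite D \<and> D \<subseteq> X}"
  then have "(\<lambda>n. ereal (real (card (set_traj f D n)) / real n)) \<longlonglongrightarrow> ereal (traj_rate f D)"
    by (intro tendsto_ereal traj_rate_LIMSEQ) auto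
  then show "lim (\<lambda>n. ereal (real (card (\<Union>i<n. (f ^^ i) ` D)) / real n)) = ereal (traj_rate f D)"
    unfolding set_traj_def by (rule limI)
qed

text \<open>Cardinalities are integers: a trajectory growing at every step gains at least one point
  each time and has rate at least 1. Rate zero therefore makes it stall at some step, and a stalled
  trajectory is invariant under \<open>f\<close>.\<close>

lemma traj_rate_zero_imp_bounded:
  assumes D: "finite D" and rate: "traj_rate f D = 0"
  obtains n where "\<And>i. (f ^^ i) ` D \<subseteq> set_traj f D n"
proof -
  have "\<exists>n. set_traj f D (Suc n) = set_traj f D n"
  proof (rule ccontr)
    assume "\<nexists>n. set_traj f D (Suc n) = set_traj f D n"
    then have "card (set_traj f D n) < card (set_traj f D (Suc n))" for n
      by (intro psubset_card_mono finite_set_traj D) (auto simp: set_traj_Suc)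
    then have "strict_mono (\<lambda>n. card (set_traj f D n))" by (simp add: strict_mono_Suc_iff)
    then have "n \<le> card (set_traj f D n)" for n by (rule strict_mono_imp_increasing)
    then have "1 \<le> traj_rate f D"
      by (intro LIMSEQ_le_const[OF traj_rate_LIMSEQ[OF D]] exI[of _ 1]) (auto simp: le_divide_eq)
    with rate show False by simp
  qed
  then obtain n where n: "set_traj f D (Suc n) = set_traj f D n" ..
  have inv: "f ` set_traj f D n \<subseteq> set_traj f D n"
  proof -
    have "set_traj f D (1 + n) = set_traj f D 1 \<union> f ` set_traj f D n"
      using set_traj_add[of f D 1 n] by simp
    with n show ?thesis by auto
  qed
  have "(f ^^ i) ` D \<subseteq> set_traj f D n" for i
  proof (induction i)
    case 0
    have "(f ^^ 0) ` D \<subseteq> set_traj f D (Suc n)" unfolding set_traj_def by blast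
    with n show ?case by simp
  next
    case (Suc i)
    have "(f ^^ Suc i) ` D = f ` (f ^^ i) ` D" by (simp add: image_image)
    with Suc inv show ?case by blast
  qed
  then show thesis by (rule that)
qed

section \<open>Trajectories of open covers\<close>

text \<open>The order of \<open>cov_functor\<close> with the arguments exchanged: the finer cover
  comes first.\<close>

definition refines :: "'b set set \<Rightarrow> 'b set set \<Rightarrow> bool" where
  "refines \<V> \<U> \<longleftrightarrow> (\<forall>V\<in>\<V>. \<exists>U\<in>\<U>. V \<subseteq> U)"

text \<open>The iterated join inside \<open>top_entropy\<close>; at index 0 it is
  \<open>\<U>\<close>, not the trivial cover.\<close>

definition cover_traj :: "'b topology \<Rightarrow> ('b \<Rightarrow> 'b) \<Rightarrow> 'b set set \<Rightarrow> nat \<Rightarrow> 'b set set" where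
  "cover_traj P g \<U> n = foldl cover_join \<U> (map (\<lambda>i. cover_pullback P (g ^^ i) \<U>) [1..<n])"

lemma cover_traj_1: "cover_traj P g \<U> (Suc 0) = \<U>"
  by (simp add: cover_traj_def)

lemma cover_traj_Suc:
  "0 < n \<Longrightarrow> cover_traj P g \<U> (Suc n) = cover_join (cover_traj P g \<U> n) (cover_pullback P (g ^^ n) \<U>)"
  by (simp add: cover_traj_def)

lemma continuous_map_funpow: "continuous_map P P g \<Longrightarrow> continuous_map P P (g ^^ i)"
  by (induction i) (auto intro: continuous_map_compose continuous_map_id simp: id_def)

lemma cover_traj_open_covers:
  assumes "continuous_map P P g" "\<U> \<in> open_covers P"
  shows "cover_traj P g \<U> n \<in> open_covers P"
proof (induction n)
  case 0
  show ?case using assms by (simp add: cover_traj_def)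
next
  case (Suc n)
  show ?case
  proof (cases n)
    case 0
    then show ?thesis using assms by (simp add: cover_traj_1)
  next
    case (Suc m)
    then show ?thesis
      using Suc.IH assms
      by (simp add: cover_traj_Suc cover_join_open_covers
          cover_pullback_open_covers[OF continuous_map_funpow] del: funpow.simps)
  qed
qed

lemma cover_pullback_funpow:
  assumes "continuous_map P P g"
  shows "cover_pullback P (g ^^ m) (cover_pullback P (g ^^ n) \<U>) = cover_pullback P (g ^^ (m + n)) \<U>"
proof -
  have "(g ^^ (m + n)) z = (g ^^ n) ((g ^^ m) z)" for z
    by (metis add.commute comp_apply funpow_add)
  then have "(g ^^ m) -` ((g ^^ n) -` U \<inter> topspace P) \<inter> topspace P = (g ^^ (m + n)) -` U \<inter> topspace P" for U
    using continuous_map_funspace[OF continuous_map_funpow[OF assms, of m]] by auto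
  then show ?thesis
    unfolding cover_pullback_def image_image by simp
qed

text \<open>Both indices are positive, since a trajectory of length 0 still contributes a factor
  \<open>\<U>\<close>, which would spoil the splitting.\<close>

lemma cover_traj_add:
  assumes g: "continuous_map P P g" and "0 < m" "0 < n"
  shows "cover_traj P g \<U> (m + n) = cover_join (cover_traj P g \<U> m) (cover_pullback P (g ^^ m) (cover_traj P g \<U> n))"
  using \<open>0 < n\<close>
proof (induction n rule: nat_induct_non_zero)
  case 1
  show ?case using \<open>0 < m\<close> by (simp add: cover_traj_1 cover_traj_Suc)
next
  case (Suc n)
  then show ?case
    using \<open>0 < m\<close>
    by (simp add: cover_traj_Suc cover_pullback_join cover_pullback_funpow[OF g] cover_join_assoc)
qed

section \<open>Cover numbers under joins and refinement\<close>

lemma cover_number_join_le: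
  assumes P: "compact_space P" and \<U>: "\<U> \<in> open_covers P" and \<V>: "\<V> \<in> open_covers P"
  shows "cover_number P (cover_join \<U> \<V>) \<le> cover_number P \<U> * cover_number P \<V>"
proof -
  obtain \<U>' where U: "\<U>' \<subseteq> \<U>" "finite \<U>'" "\<Union>\<U>' = topspace P" "card \<U>' = cover_number P \<U>"
    by (rule cover_number_witness[OF P \<U>])
  obtain \<V>' where V: "\<V>' \<subseteq> \<V>" "finite \<V>'" "\<Union>\<V>' = topspace P" "card \<V>' = cover_number P \<V>"
    by (rule cover_number_witness[OF P \<V>])
  \<comment> \<open>The pairwise intersections of two minimal subcovers are an image of their
    cartesian product, which gives the product bound.\<close>
  have eq: "cover_join \<U>' \<V>' = (\<lambda>(U, V). U \<inter> V) ` (\<U>' \<times> \<V>')"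
    unfolding cover_join_def by auto
  have "\<Union>(cover_join \<U>' \<V>') = \<Union>\<U>' \<inter> \<Union>\<V>'"
    unfolding cover_join_def by blast
  moreover have "cover_join \<U>' \<V>' \<subseteq> cover_join \<U> \<V>"
    unfolding cover_join_def using U(1) V(1) by blast
  moreover have "finite (cover_join \<U>' \<V>')"
    unfolding eq using U(2) V(2) by simp
  ultimately have "cover_number P (cover_join \<U> \<V>) \<le> card (cover_join \<U>' \<V>')"
    using U(3) V(3) by (intro cover_number_le) simp_all
  also have "\<dots> \<le> card (\<U>' \<times> \<V>')"
    unfolding eq using U V by (intro card_image_le) auto
  finally show ?thesis using U V by (simp add: card_cartesian_product)
qed

text \<open>Enlarging each member of a minimal subcover of the finer cover to a member of
  \<open>\<U>\<close> gives a subcover of \<open>\<U>\<close> with no more members.\<close>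

lemma cover_number_mono:
  assumes P: "compact_space P" and \<V>: "\<V> \<in> open_covers P" and \<U>: "\<U> \<in> open_covers P"
    and ref: "refines \<V> \<U>"
  shows "cover_number P \<U> \<le> cover_number P \<V>"
proof -
  obtain \<V>' where V: "\<V>' \<subseteq> \<V>" "finite \<V>'" "\<Union>\<V>' = topspace P" "card \<V>' = cover_number P \<V>"
    by (rule cover_number_witness[OF P \<V>])
  obtain u where u: "\<And>V. V \<in> \<V> \<Longrightarrow> u V \<in> \<U> \<and> V \<subseteq> u V"
    using ref unfolding refines_def by metis
  have "\<Union>(u ` \<V>') = topspace P"
  proof
    show "\<Union>(u ` \<V>') \<subseteq> topspace P" using u V(1) \<U> by (fastforce simp: open_covers_def)
    show "topspace P \<subseteq> \<Union>(u ` \<V>')" using u V(1,3) by blast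
  qed
  then have "cover_number P \<U> \<le> card (u ` \<V>')"
    using u V by (intro cover_number_le) auto
  also have "\<dots> \<le> card \<V>'" by (rule card_image_le[OF V(2)])
  finally show ?thesis using V(4) by simp
qed

lemma refines_join:
  assumes "refines \<V> \<U>" "refines \<V>' \<U>'"
  shows "refines (cover_join \<V> \<V>') (cover_join \<U> \<U>')"
  unfolding refines_def
proof
  fix W assume "W \<in> cover_join \<V> \<V>'"
  then obtain V V' where W: "W = V \<inter> V'" "V \<in> \<V>" "V' \<in> \<V>'" by (auto simp: cover_join_def)
  obtain U where U: "U \<in> \<U>" "V \<subseteq> U" using W(2) assms(1) by (auto simp: refines_def)
  obtain U' where U': "U' \<in> \<U>'" "V' \<subseteq> U'" using W(3) assms(2) by (auto simp: refines_def)
  have "U \<inter> U' \<in> cover_join \<U> \<U>'" using U U' by (auto simp: cover_join_def)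
  moreover have "W \<subseteq> U \<inter> U'" using W(1) U(2) U'(2) by blast
  ultimately show "\<exists>U\<in>cover_join \<U> \<U>'. W \<subseteq> U" by blast
qed

lemma refines_pullback: "refines \<V> \<U> \<Longrightarrow> refines (cover_pullback P g \<V>) (cover_pullback P g \<U>)"
proof -
  assume "refines \<V> \<U>"
  then have "\<exists>U\<in>\<U>. g -` V \<inter> topspace P \<subseteq> g -` U \<inter> topspace P" if "V \<in> \<V>" for V
    using that unfolding refines_def by (meson Int_mono order_refl vimage_mono)
  then show ?thesis
    unfolding refines_def cover_pullback_def by simp
qed

lemma refines_traj:
  assumes "refines \<V> \<U>" "0 < n"
  shows "refines (cover_traj P g \<V> n) (cover_traj P g \<U> n)"
  using assms(2)
  by (induction n rule: nat_induct_non_zero)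
    (simp_all add: assms(1) cover_traj_1 cover_traj_Suc refines_join refines_pullback)

lemma cover_number_pos:
  assumes "compact_space P" "topspace P \<noteq> {}" "\<U> \<in> open_covers P"
  shows "0 < cover_number P \<U>"
proof -
  obtain \<V> where "finite \<V>" "\<Union>\<V> = topspace P" "card \<V> = cover_number P \<U>"
    by (rule cover_number_witness[OF assms(1,3)])
  with assms(2) show ?thesis by (metis Union_empty card_gt_0_iff)
qed

text \<open>Nonemptiness keeps the cover numbers away from \<open>ln 0\<close>.\<close>

locale compact_dynamics =
  fixes P :: "'b topology" and g :: "'b \<Rightarrow> 'b"
  assumes compact: "compact_space P" and inhabited: "topspace P \<noteq> {}"
    and continuous: "continuous_map P P g"
begin

definition log_number :: "'b set set \<Rightarrow> nat \<Rightarrow> real" where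
  "log_number \<U> n = ln (real (cover_number P (cover_traj P g \<U> n)))"

lemma traj_open_covers: "\<U> \<in> open_covers P \<Longrightarrow> cover_traj P g \<U> n \<in> open_covers P"
  by (rule cover_traj_open_covers[OF continuous])

lemma traj_number_pos: "\<U> \<in> open_covers P \<Longrightarrow> 0 < cover_number P (cover_traj P g \<U> n)"
  by (intro cover_number_pos compact inhabited traj_open_covers)

lemma log_number_nonneg: "\<U> \<in> open_covers P \<Longrightarrow> 0 \<le> log_number \<U> n"
  using traj_number_pos[of \<U> n] by (auto simp: log_number_def)

text \<open>Cover numbers are submultiplicative under joins and do not grow under pullback, so their
  logarithms along the trajectory satisfy the hypotheses of Fekete's lemma.\<close>

lemma log_number_average_convergent:
  assumes \<U>: "\<U> \<in> open_covers P"
  shows "convergent (\<lambda>n. log_number \<U> n / real n)"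
proof (rule subadditive_imp_convergent_average)
  fix m n :: nat assume "0 < m" "0 < n"
  let ?N = "cover_number P"
  have "?N (cover_traj P g \<U> (m + n)) \<le> ?N (cover_traj P g \<U> m) * ?N (cover_pullback P (g ^^ m) (cover_traj P g \<U> n))"
    unfolding cover_traj_add[OF continuous \<open>0 < m\<close> \<open>0 < n\<close>]
    by (intro cover_number_join_le compact traj_open_covers cover_pullback_open_covers[where Y = P]
        continuous_map_funpow continuous \<U>)
  also have "\<dots> \<le> ?N (cover_traj P g \<U> m) * ?N (cover_traj P g \<U> n)"
    by (intro mult_left_mono cover_number_pullback_le[where Y = P] compact traj_open_covers
        continuous_map_funpow continuous \<U>) simp
  finally have "real (?N (cover_traj P g \<U> (m + n)))
      \<le> real (?N (cover_traj P g \<U> m)) * real (?N (cover_traj P g \<U> n))"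
    by (metis of_nat_mono of_nat_mult)
  then have "log_number \<U> (m + n) \<le> ln (real (?N (cover_traj P g \<U> m)) * real (?N (cover_traj P g \<U> n)))"
    unfolding log_number_def using traj_number_pos[OF \<U>] by (intro ln_mono) auto
  then show "log_number \<U> (m + n) \<le> log_number \<U> m + log_number \<U> n"
    using traj_number_pos[OF \<U>] by (simp add: log_number_def ln_mult)
qed (rule log_number_nonneg[OF \<U>])

definition cover_rate :: "'b set set \<Rightarrow> real" where
  "cover_rate \<U> = lim (\<lambda>n. log_number \<U> n / real n)"

lemma cover_rate_LIMSEQ:
  "\<U> \<in> open_covers P \<Longrightarrow> (\<lambda>n. log_number \<U> n / real n) \<longlonglongrightarrow> cover_rate \<U>"
  unfolding cover_rate_def by (intro convergent_LIMSEQ_iff[THEN iffD1] log_number_average_convergent)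

lemma cover_rate_nonneg: "\<U> \<in> open_covers P \<Longrightarrow> 0 \<le> cover_rate \<U>"
  by (rule LIMSEQ_le_const[OF cover_rate_LIMSEQ]) (simp_all add: log_number_nonneg)

text \<open>Bounds found for fine covers pass to all covers that they refine; this is how a cofinal
  family determines the entropy.\<close>

lemma cover_rate_mono:
  assumes "\<V> \<in> open_covers P" "\<U> \<in> open_covers P" "refines \<V> \<U>"
  shows "cover_rate \<U> \<le> cover_rate \<V>"
proof (rule LIMSEQ_le[OF cover_rate_LIMSEQ[OF assms(2)] cover_rate_LIMSEQ[OF assms(1)]],
    intro exI[of _ 1] allI impI)
  fix n :: nat assume "1 \<le> n"
  then have "cover_number P (cover_traj P g \<U> n) \<le> cover_number P (cover_traj P g \<V> n)"
    by (intro cover_number_mono compact traj_open_covers assms refines_traj) auto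
  then show "log_number \<U> n / real n \<le> log_number \<V> n / real n"
    unfolding log_number_def using traj_number_pos[OF assms(2), of n]
    by (intro divide_right_mono ln_mono) auto
qed

lemma cover_rate_zero_if_bounded:
  assumes \<U>: "\<U> \<in> open_covers P" and bound: "\<And>n. 0 < n \<Longrightarrow> cover_number P (cover_traj P g \<U> n) \<le> B"
  shows "cover_rate \<U> = 0"
proof -
  have "(\<lambda>n. ln (real B) / real n) \<longlonglongrightarrow> 0" by (rule lim_const_over_n)
  moreover have "log_number \<U> n / real n \<le> ln (real B) / real n" if "1 \<le> n" for n
    unfolding log_number_def using bound[of n] traj_number_pos[OF \<U>, of n] that
    by (intro divide_right_mono ln_mono) auto
  ultimately have "cover_rate \<U> \<le> 0"
    by (intro LIMSEQ_le[OF cover_rate_LIMSEQ[OF \<U>]]) auto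
  with cover_rate_nonneg[OF \<U>] show ?thesis by simp
qed

text \<open>The averages already converge in the reals, so each limit in \<open>ereal\<close> is
  finite and agrees with the real one.\<close>

lemma top_entropy_eq: "top_entropy P g = (SUP \<U>\<in>open_covers P. ereal (cover_rate \<U>))"
  unfolding top_entropy_def
proof (rule SUP_cong[OF refl])
  fix \<U> assume "\<U> \<in> open_covers P"
  then have "(\<lambda>n. ereal (log_number \<U> n / real n)) \<longlonglongrightarrow> ereal (cover_rate \<U>)"
    by (intro tendsto_ereal cover_rate_LIMSEQ)
  then show "lim (\<lambda>n. ereal (1 / real n * ln (real (cover_number P
      (foldl cover_join \<U> (map (\<lambda>i. cover_pullback P (g ^^ i) \<U>) [1..<n])))))) = ereal (cover_rate \<U>)"
    by (intro limI) (simp add: log_number_def cover_traj_def)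
qed

end

section \<open>Powers of a compact Hausdorff space\<close>

text \<open>Points of \<open>P\<close> need not be functions, so coordinates are read through maps
  \<open>p x\<close>; this suits the spaces \<open>\<epsilon> X\<close>, which are powers only up to
  homeomorphism.\<close>

definition cylinder :: "'b topology \<Rightarrow> ('a \<Rightarrow> 'b \<Rightarrow> 'c) \<Rightarrow> 'a set \<Rightarrow> ('a \<Rightarrow> 'c set) \<Rightarrow> 'b set" where
  "cylinder P p D w = {z \<in> topspace P. \<forall>x\<in>D. p x z \<in> w x}"

text \<open>
  For finite \<open>F\<close> the sets \<open>topspace T - (F - {a})\<close>, \<open>a \<in> F\<close>, form an open cover of \<open>T\<close> each of whose
  members contains exactly one point of \<open>F\<close>; for \<open>F = topspace T\<close> they are the singletons.
\<close>

definition cells :: "'c topology \<Rightarrow> 'b topology \<Rightarrow> ('a \<Rightarrow> 'b \<Rightarrow> 'c) \<Rightarrow> 'c set \<Rightarrow> 'a set \<Rightarrow> 'b set set" where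
  "cells T P p F D = (\<lambda>k. cylinder P p D (\<lambda>x. topspace T - (F - {k x}))) ` (D \<rightarrow>\<^sub>E F)"

text \<open>
  The empty member makes this compatible with joins: cells over \<open>D\<close> and over \<open>E\<close> which prescribe
  different values on \<open>D \<inter> E\<close> are disjoint.
\<close>

definition point_cells :: "'c topology \<Rightarrow> 'b topology \<Rightarrow> ('a \<Rightarrow> 'b \<Rightarrow> 'c) \<Rightarrow> 'a set \<Rightarrow> 'b set set" where
  "point_cells T P p D = insert {} (cells T P p (topspace T) D)"

definition fiber :: "'b topology \<Rightarrow> ('a \<Rightarrow> 'b \<Rightarrow> 'c) \<Rightarrow> 'a set \<Rightarrow> ('a \<Rightarrow> 'c) \<Rightarrow> 'b set" where
  "fiber P p D k = {z \<in> topspace P. \<forall>x\<in>D. p x z = k x}"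

lemma cells_topspace: "cells T P p (topspace T) D = fiber P p D ` (D \<rightarrow>\<^sub>E topspace T)"
  unfolding cells_def fiber_def cylinder_def
proof (rule image_cong[OF refl])
  fix k assume "k \<in> D \<rightarrow>\<^sub>E topspace T"
  then have "topspace T - (topspace T - {k x}) = {k x}" if "x \<in> D" for x using that by auto
  then show "{z \<in> topspace P. \<forall>x\<in>D. p x z \<in> topspace T - (topspace T - {k x})} = {z \<in> topspace P. \<forall>x\<in>D. p x z = k x}"
    by simp
qed

lemma point_cells_eq: "point_cells T P p D = insert {} (fiber P p D ` (D \<rightarrow>\<^sub>E topspace T))"
  by (simp add: point_cells_def cells_topspace)

lemma point_cellsE:
  assumes "V \<in> point_cells T P p D"
  obtains "V = {}" | k where "k \<in> D \<rightarrow>\<^sub>E topspace T" "V = fiber P p D k"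
  using assms by (auto simp: point_cells_eq)

lemma fiber_in_point_cells: "k \<in> D \<rightarrow> topspace T \<Longrightarrow> fiber P p D k \<in> point_cells T P p D"
proof -
  assume k: "k \<in> D \<rightarrow> topspace T"
  have "fiber P p D k = fiber P p D (restrict k D)" by (simp add: fiber_def)
  moreover have "restrict k D \<in> D \<rightarrow>\<^sub>E topspace T" using k by auto
  ultimately show ?thesis by (auto simp: point_cells_eq)
qed

lemma point_cells_join: "cover_join (point_cells T P p D) (point_cells T P p E) = point_cells T P p (D \<union> E)"
proof (intro equalityI subsetI)
  fix W assume "W \<in> cover_join (point_cells T P p D) (point_cells T P p E)"
  then obtain U V where W: "W = U \<inter> V" and U: "U \<in> point_cells T P p D" and V: "V \<in> point_cells T P p E"
    by (auto simp: cover_join_def)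
  show "W \<in> point_cells T P p (D \<union> E)"
  proof (cases "W = {}")
    case True
    then show ?thesis by (simp add: point_cells_eq)
  next
    case False
    then obtain k l where k: "k \<in> D \<rightarrow>\<^sub>E topspace T" "U = fiber P p D k"
      and l: "l \<in> E \<rightarrow>\<^sub>E topspace T" "V = fiber P p E l"
      using U V W by (elim point_cellsE) auto
    \<comment> \<open>A common point forces the two labels to agree on the overlap, so they glue to
      one label on \<open>D \<union> E\<close>.\<close>
    from False obtain z where "z \<in> fiber P p D k" "z \<in> fiber P p E l" using W k l by auto
    then have "\<And>x. x \<in> D \<Longrightarrow> x \<in> E \<Longrightarrow> k x = l x" by (auto simp: fiber_def)
    then have "W = fiber P p (D \<union> E) (\<lambda>x. if x \<in> D then k x else l x)"
      unfolding W k l by (auto simp: fiber_def)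
    also have "\<dots> \<in> point_cells T P p (D \<union> E)"
      using k(1) l(1) by (intro fiber_in_point_cells) auto
    finally show ?thesis .
  qed
next
  fix W assume "W \<in> point_cells T P p (D \<union> E)"
  then show "W \<in> cover_join (point_cells T P p D) (point_cells T P p E)"
  proof (cases rule: point_cellsE)
    case 1
    then show ?thesis by (auto simp: cover_join_def point_cells_eq)
  next
    case (2 k)
    then have "W = fiber P p D k \<inter> fiber P p E k" by (auto simp: fiber_def)
    moreover have "fiber P p D k \<in> point_cells T P p D" "fiber P p E k \<in> point_cells T P p E"
      using 2 by (auto intro!: fiber_in_point_cells)
    ultimately show ?thesis unfolding cover_join_def by blast
  qed
qed

text \<open>Two different powers occur because naturality concerns maps between different sets. A
  label on \<open>D\<close> that is not constant on the fibres of \<open>f\<close> pulls back to the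
  empty set, which is a member by design.\<close>

lemma point_cells_pullback:
  assumes g: "\<And>z. z \<in> topspace Q \<Longrightarrow> g z \<in> topspace P"
    and pg: "\<And>x z. x \<in> D \<Longrightarrow> z \<in> topspace Q \<Longrightarrow> p x (g z) = q (f x) z"
  shows "cover_pullback Q g (point_cells T P p D) = point_cells T Q q (f ` D)"
proof (intro equalityI subsetI)
  have pull: "g -` fiber P p D k \<inter> topspace Q = {z \<in> topspace Q. \<forall>x\<in>D. q (f x) z = k x}" for k
    using g pg by (auto simp: fiber_def)
  {
    fix W assume "W \<in> cover_pullback Q g (point_cells T P p D)"
    then obtain V where V: "V \<in> point_cells T P p D" "W = g -` V \<inter> topspace Q"
      by (auto simp: cover_pullback_def)
    from V(1) show "W \<in> point_cells T Q q (f ` D)"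
    proof (cases rule: point_cellsE)
      case 1
      with V show ?thesis by (simp add: point_cells_eq)
    next
      case (2 k)
      show ?thesis
      proof (cases "W = {}")
        case True
        then show ?thesis by (simp add: point_cells_eq)
      next
        case False
        then obtain z where z: "\<forall>x\<in>D. q (f x) z = k x" using V 2 pull by auto
        \<comment> \<open>The coordinates of the chosen point provide the label on the image of
          \<open>D\<close>, without inverting \<open>f\<close>.\<close>
        have "W = fiber Q q (f ` D) (\<lambda>y. q y z)"
          unfolding V 2 pull using z by (auto simp: fiber_def)
        also have "\<dots> \<in> point_cells T Q q (f ` D)"
          using z 2(1) by (intro fiber_in_point_cells) auto
        finally show ?thesis .
      qed
    qed
  next
    fix W assume "W \<in> point_cells T Q q (f ` D)"
    then show "W \<in> cover_pullback Q g (point_cells T P p D)"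
    proof (cases rule: point_cellsE)
      case 1
      then show ?thesis by (auto simp: cover_pullback_def point_cells_eq)
    next
      case (2 k)
      have "W = g -` fiber P p D (k \<circ> f) \<inter> topspace Q"
        unfolding 2 pull by (auto simp: fiber_def)
      moreover have "fiber P p D (k \<circ> f) \<in> point_cells T P p D"
        using 2(1) by (intro fiber_in_point_cells) auto
      ultimately show ?thesis unfolding cover_pullback_def by blast
    qed
  }
qed

section \<open>Covers whose members distinguish values of coordinates\<close>

definition separates :: "('a \<Rightarrow> 'b \<Rightarrow> 'c) \<Rightarrow> 'c set \<Rightarrow> 'b set set \<Rightarrow> 'a set \<Rightarrow> bool" where
  "separates p F \<U> D \<longleftrightarrow>
     (\<forall>U\<in>\<U>. \<forall>z\<in>U. \<forall>z'\<in>U. \<forall>x\<in>D. p x z \<in> F \<longrightarrow> p x z' \<in> F \<longrightarrow> p x z = p x z')"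

text \<open>A cell with label \<open>k\<close> admits at \<open>x\<close> no value of
  \<open>F\<close> other than \<open>k x\<close>.\<close>

lemma separates_cells: "separates p F (cells T P p F D) D"
  by (auto simp: separates_def cells_def cylinder_def)

lemma separates_point_cells: "separates p F (point_cells T P p D) D"
  by (auto simp: separates_def point_cells_eq fiber_def)

lemma separates_join:
  assumes "separates p F \<U> D" "separates p F \<V> E"
  shows "separates p F (cover_join \<U> \<V>) (D \<union> E)"
  unfolding separates_def
proof (intro ballI impI)
  fix W z z' x
  assume "W \<in> cover_join \<U> \<V>" and z: "z \<in> W" "z' \<in> W" and x: "x \<in> D \<union> E" "p x z \<in> F" "p x z' \<in> F"
  then obtain U V where W: "W = U \<inter> V" "U \<in> \<U>" "V \<in> \<V>" by (auto simp: cover_join_def)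
  from x(1) show "p x z = p x z'"
  proof
    assume "x \<in> D"
    then show ?thesis using assms(1) W z x(2,3) unfolding separates_def by (metis IntD1)
  next
    assume "x \<in> E"
    then show ?thesis using assms(2) W z x(2,3) unfolding separates_def by (metis IntD2)
  qed
qed

lemma separates_pullback:
  assumes sep: "separates p F \<U> D"
    and pg: "\<And>x z. x \<in> D \<Longrightarrow> z \<in> topspace P \<Longrightarrow> p x (g z) = p (f x) z"
  shows "separates p F (cover_pullback P g \<U>) (f ` D)"
  unfolding separates_def
proof (intro ballI impI)
  fix W z z' y
  assume "W \<in> cover_pullback P g \<U>" and z: "z \<in> W" "z' \<in> W" and y: "y \<in> f ` D" "p y z \<in> F" "p y z' \<in> F"
  then obtain U where U: "W = g -` U \<inter> topspace P" "U \<in> \<U>" by (auto simp: cover_pullback_def)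
  obtain x where x: "x \<in> D" "y = f x" using y by auto
  have "p x (g z) = p y z" "p x (g z') = p y z'" using pg x z U by auto
  then show "p y z = p y z'"
    using sep U z x y unfolding separates_def by (metis IntE vimageE)
qed

section \<open>Open covers of a power described by its coordinate maps\<close>

locale topological_power =
  fixes P :: "'b topology" and T :: "'c topology" and X :: "'a set" and p :: "'a \<Rightarrow> 'b \<Rightarrow> 'c"
  assumes compact_power: "compact_space P" and Hausdorff_base: "Hausdorff_space T"
    and base_nonempty: "topspace T \<noteq> {}"
    and homeo: "homeomorphic_map P (product_topology (\<lambda>_. T) X) (\<lambda>z. \<lambda>x\<in>X. p x z)"
begin

lemma proj_continuous: "x \<in> X \<Longrightarrow> continuous_map P T (p x)"
  using homeomorphic_imp_continuous_map[OF homeo] by (auto simp: continuous_map_componentwise)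

lemma proj_mem: "x \<in> X \<Longrightarrow> z \<in> topspace P \<Longrightarrow> p x z \<in> topspace T"
  using continuous_map_funspace[OF proj_continuous] by auto

lemma lift:
  assumes "k \<in> X \<rightarrow> topspace T"
  obtains z where "z \<in> topspace P" "\<forall>x\<in>X. p x z = k x"
proof -
  have "restrict k X \<in> topspace (product_topology (\<lambda>_. T) X)" using assms by auto
  then obtain z where z: "z \<in> topspace P" "restrict k X = (\<lambda>x\<in>X. p x z)"
    unfolding homeomorphic_imp_surjective_map[OF homeo, symmetric] by (rule imageE) blast
  have "\<forall>x\<in>X. p x z = k x"
    using fun_cong[OF z(2)] by (metis restrict_apply')
  with z(1) show thesis by (rule that)
qed

lemma lift_over:
  assumes "D \<subseteq> X" "k \<in> D \<rightarrow> topspace T"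
  obtains z where "z \<in> topspace P" "\<forall>x\<in>D. p x z = k x"
proof -
  obtain a where "a \<in> topspace T" using base_nonempty by blast
  then have "(\<lambda>x. if x \<in> D then k x else a) \<in> X \<rightarrow> topspace T" using assms(2) by auto
  then obtain z where "z \<in> topspace P" "\<forall>x\<in>X. p x z = (if x \<in> D then k x else a)"
    by (rule lift)
  moreover from this(2) have "\<forall>x\<in>D. p x z = k x" using assms(1) by auto
  ultimately show thesis by (intro that)
qed

lemma power_nonempty: "topspace P \<noteq> {}"
  by (rule lift_over[of "{}" undefined]) auto

lemma openin_cylinder:
  assumes "finite D" "D \<subseteq> X" "\<And>x. x \<in> D \<Longrightarrow> openin T (w x)"
  shows "openin P (cylinder P p D w)"
  using assms
proof (induction D rule: finite_induct)
  case empty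
  show ?case by (simp add: cylinder_def)
next
  case (insert x D)
  have "cylinder P p (insert x D) w = {z \<in> topspace P. p x z \<in> w x} \<inter> cylinder P p D w"
    by (auto simp: cylinder_def)
  moreover have "openin P {z \<in> topspace P. p x z \<in> w x}"
    using insert.prems by (intro openin_continuous_map_preimage[OF proj_continuous]) auto
  ultimately show ?case using insert by (simp add: openin_Int)
qed

text \<open>Boxes restricting finitely many coordinates form a base of the product topology, and the
  homeomorphism carries them to \<open>P\<close>. Taking \<open>w\<close> to be the whole base off
  \<open>D\<close> lets \<open>D\<close> be enlarged later without changing the cylinder.\<close>

lemma cylinder_neighbourhood:
  assumes U: "openin P U" and z: "z \<in> U"
  obtains D w where "finite D" "D \<subseteq> X" "\<forall>x. openin T (w x)" "\<forall>x. x \<notin> D \<longrightarrow> w x = topspace T"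
    "z \<in> cylinder P p D w" "cylinder P p D w \<subseteq> U"
proof -
  let ?h = "\<lambda>z. \<lambda>x\<in>X. p x z"
  have "openin (product_topology (\<lambda>_. T) X) (?h ` U)"
    using homeomorphic_imp_open_map[OF homeo] U by (auto simp: open_map_def)
  then obtain u where u: "finite {x \<in> X. u x \<noteq> topspace T}" "\<forall>x\<in>X. openin T (u x)"
      "?h z \<in> Pi\<^sub>E X u" "Pi\<^sub>E X u \<subseteq> ?h ` U"
    using z unfolding openin_product_topology_alt by blast
  define D where "D = {x \<in> X. u x \<noteq> topspace T}"
  define w where "w = (\<lambda>x. if x \<in> D then u x else topspace T)"
  have wu: "w x = u x" if "x \<in> X" for x using that by (auto simp: w_def D_def)
  have Up: "U \<subseteq> topspace P" by (rule openin_subset[OF U])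
  have cyl: "z' \<in> cylinder P p D w \<longleftrightarrow> z' \<in> topspace P \<and> ?h z' \<in> Pi\<^sub>E X u" for z'
    using proj_mem by (auto simp: cylinder_def D_def w_def PiE_iff)
  show thesis
  proof (rule that)
    show "finite D" "D \<subseteq> X" using u(1) by (auto simp: D_def)
    show "\<forall>x. openin T (w x)" using u(2) by (auto simp: w_def D_def)
    show "\<forall>x. x \<notin> D \<longrightarrow> w x = topspace T" by (simp add: w_def)
    show "z \<in> cylinder P p D w" using cyl u(3) z Up by blast
    show "cylinder P p D w \<subseteq> U"
    proof
      fix z' assume "z' \<in> cylinder P p D w"
      then have z': "z' \<in> topspace P" and "?h z' \<in> ?h ` U"
        using cyl[of z'] subsetD[OF u(4), of "?h z'"] by simp_all
      then obtain z'' where z'': "?h z' = ?h z''" "z'' \<in> U" by (elim imageE)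
      have "z' = z''"
        by (rule inj_onD[OF homeomorphic_imp_injective_map[OF homeo] z''(1) z'])
          (use z''(2) Up in blast)
      with z''(2) show "z' \<in> U" by simp
    qed
  qed
qed

text \<open>By compactness finitely many basic cylinders refine the cover; the union of their finite
  supports serves as one common support.\<close>

lemma finite_cylinder_refinement:
  assumes \<U>: "\<U> \<in> open_covers P"
  obtains D \<W> where "finite D" "D \<subseteq> X" "finite \<W>" "cylinder P p D ` \<W> \<in> open_covers P"
    "refines (cylinder P p D ` \<W>) \<U>"
proof -
  have "\<exists>D w. finite D \<and> D \<subseteq> X \<and> (\<forall>x. openin T (w x)) \<and> (\<forall>x. x \<notin> D \<longrightarrow> w x = topspace T) \<and>
      z \<in> cylinder P p D w \<and> (\<exists>U\<in>\<U>. cylinder P p D w \<subseteq> U)" if "z \<in> topspace P" for z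
  proof -
    obtain U where U: "U \<in> \<U>" "z \<in> U" "openin P U" using \<U> \<open>z \<in> topspace P\<close> by (auto simp: open_covers_def)
    from U(3,2) obtain D w where "finite D" "D \<subseteq> X" "\<forall>x. openin T (w x)"
        "\<forall>x. x \<notin> D \<longrightarrow> w x = topspace T" "z \<in> cylinder P p D w" "cylinder P p D w \<subseteq> U"
      by (rule cylinder_neighbourhood)
    with U(1) show ?thesis by (intro exI[of _ D] exI[of _ w]) auto
  qed
  then obtain d w where dw: "\<And>z. z \<in> topspace P \<Longrightarrow> finite (d z) \<and> d z \<subseteq> X \<and> (\<forall>x. openin T (w z x)) \<and>
      (\<forall>x. x \<notin> d z \<longrightarrow> w z x = topspace T) \<and>
      z \<in> cylinder P p (d z) (w z) \<and> (\<exists>U\<in>\<U>. cylinder P p (d z) (w z) \<subseteq> U)"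
    by metis
  let ?c = "\<lambda>z. cylinder P p (d z) (w z)"
  have open_c: "openin P (?c z)" if "z \<in> topspace P" for z using dw[OF that] by (intro openin_cylinder) auto
  have "\<forall>V\<in>?c ` topspace P. openin P V" "topspace P \<subseteq> \<Union>(?c ` topspace P)"
    using dw open_c by blast+
  then obtain \<V> where \<V>: "finite \<V>" "\<V> \<subseteq> ?c ` topspace P" "topspace P \<subseteq> \<Union>\<V>"
    using compact_power unfolding compact_space_alt by meson
  from finite_subset_image[OF \<V>(1,2)] obtain Z where "finite Z" "Z \<subseteq> topspace P" "\<V> = ?c ` Z"
    by blast
  with \<V>(3) have Z: "finite Z" "Z \<subseteq> topspace P" "topspace P \<subseteq> \<Union>(?c ` Z)" by simp_all
  let ?D = "\<Union>(d ` Z)"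
  have "finite (d z) \<and> d z \<subseteq> X" if "z \<in> Z" for z using dw[of z] Z(2) that by blast
  then have D: "finite ?D" "?D \<subseteq> X" using Z(1) by auto
  \<comment> \<open>In the coordinates added to \<open>d z\<close> the constraint is the whole base,
    so the larger support defines the same set.\<close>
  have c: "cylinder P p ?D (w z) = ?c z" if "z \<in> Z" for z
  proof -
    have "p x y \<in> w z x" if "y \<in> topspace P" "x \<in> ?D" "x \<notin> d z" for x y
    proof -
      have "z \<in> topspace P" "x \<in> X" using \<open>z \<in> Z\<close> Z(2) D(2) that(2) by blast+
      then show ?thesis using dw[of z] that(1,3) proj_mem by simp
    qed
    then show ?thesis using that unfolding cylinder_def by blast
  qed
  have image: "cylinder P p ?D ` (w ` Z) = ?c ` Z" unfolding image_image using c by simp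
  show thesis
  proof (rule that[OF D, of "w ` Z"])
    show "finite (w ` Z)" using Z by simp
    have "\<Union>(?c ` Z) \<subseteq> topspace P" by (auto simp: cylinder_def)
    then show "cylinder P p ?D ` (w ` Z) \<in> open_covers P"
      unfolding image open_covers_def using Z open_c by auto
    show "refines (cylinder P p ?D ` (w ` Z)) \<U>"
      unfolding image refines_def using dw Z(2) by blast
  qed
qed

text \<open>Finite sets are closed in a Hausdorff space, so the constraints defining the cells are
  open.\<close>

lemma cells_open_covers:
  assumes D: "finite D" "D \<subseteq> X" and F: "finite F" "F \<noteq> {}" "F \<subseteq> topspace T"
  shows "cells T P p F D \<in> open_covers P"
proof -
  have "openin P (cylinder P p D (\<lambda>x. topspace T - (F - {k x})))" for k
    using F Hausdorff_base D
    by (intro openin_cylinder openin_diff openin_topspace)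
      (auto intro: closedin_Hausdorff_finite)
  moreover have "z \<in> \<Union>(cells T P p F D)" if z: "z \<in> topspace P" for z
  proof -
    obtain a where a: "a \<in> F" using F by auto
    \<comment> \<open>A value outside \<open>F\<close> satisfies every constraint, so the arbitrary
      label \<open>a\<close> will do there.\<close>
    define k where "k = (\<lambda>x\<in>D. if p x z \<in> F then p x z else a)"
    have "k \<in> D \<rightarrow>\<^sub>E F" using a by (auto simp: k_def)
    moreover have "z \<in> cylinder P p D (\<lambda>x. topspace T - (F - {k x}))"
      using z D proj_mem by (auto simp: cylinder_def k_def)
    ultimately show ?thesis unfolding cells_def by blast
  qed
  ultimately show ?thesis
    unfolding open_covers_def cells_def by (fastforce simp: cylinder_def)
qed

text \<open>Every label from \<open>D\<close> to \<open>F\<close> is realised by a point. Separation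
  keeps points realising two different labels out of a common member, so a subcover needs at least
  one member per label.\<close>

lemma separates_cover_number:
  assumes \<U>: "\<U> \<in> open_covers P" and sep: "separates p F \<U> D"
    and D: "finite D" "D \<subseteq> X" and F: "finite F" "F \<subseteq> topspace T"
  shows "card F ^ card D \<le> cover_number P \<U>"
proof -
  obtain \<V> where \<V>: "\<V> \<subseteq> \<U>" "finite \<V>" "\<Union>\<V> = topspace P" "card \<V> = cover_number P \<U>"
    by (rule cover_number_witness[OF compact_power \<U>])
  have "\<exists>V\<in>\<V>. \<exists>z\<in>V. \<forall>x\<in>D. p x z = k x" if "k \<in> D \<rightarrow>\<^sub>E F" for k
  proof -
    have "k \<in> D \<rightarrow> topspace T" using that F by auto
    then obtain z where "z \<in> topspace P" "\<forall>x\<in>D. p x z = k x" by (rule lift_over[OF D(2)])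
    then show ?thesis using \<V>(3) by blast
  qed
  then obtain v z where v: "\<And>k. k \<in> D \<rightarrow>\<^sub>E F \<Longrightarrow> v k \<in> \<V> \<and> z k \<in> v k \<and> (\<forall>x\<in>D. p x (z k) = k x)"
    by metis
  have "inj_on v (D \<rightarrow>\<^sub>E F)"
  proof (rule inj_onI)
    fix k l assume kl: "k \<in> D \<rightarrow>\<^sub>E F" "l \<in> D \<rightarrow>\<^sub>E F" "v k = v l"
    show "k = l"
    proof (rule PiE_ext[OF kl(1,2)])
      fix x assume x: "x \<in> D"
      have "p x (z k) = k x" "p x (z l) = l x" "k x \<in> F" "l x \<in> F" using v kl x by auto
      moreover have "z k \<in> v k" "z l \<in> v k" "v k \<in> \<U>" using v[OF kl(1)] v[OF kl(2)] kl(3) \<V>(1) by auto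
      ultimately show "k x = l x" using sep x unfolding separates_def by metis
    qed
  qed
  then have "card (D \<rightarrow>\<^sub>E F) \<le> card \<V>"
    using v \<V>(2) by (intro card_inj_on_le[of v]) auto
  then show ?thesis using \<V>(4) D(1) by (simp add: card_PiE)
qed

lemma point_cells_open_covers:
  assumes "finite (topspace T)" "finite D" "D \<subseteq> X"
  shows "point_cells T P p D \<in> open_covers P"
  using cells_open_covers[OF assms(2,3,1) base_nonempty order_refl]
  by (auto simp: point_cells_def open_covers_def)

text \<open>The nonempty cells already cover, which gives the upper bound; the lower bound is
  separation with \<open>F\<close> the whole base.\<close>

lemma cover_number_point_cells:
  assumes T: "finite (topspace T)" and D: "finite D" "D \<subseteq> X"
  shows "cover_number P (point_cells T P p D) = card (topspace T) ^ card D"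
proof (rule antisym)
  have "cells T P p (topspace T) D \<in> open_covers P"
    by (intro cells_open_covers D T base_nonempty order_refl)
  then have "cover_number P (point_cells T P p D) \<le> card (cells T P p (topspace T) D)"
    using T D by (intro cover_number_le) (auto simp: point_cells_def open_covers_def cells_def finite_PiE)
  also have "\<dots> \<le> card (D \<rightarrow>\<^sub>E topspace T)"
    unfolding cells_def using T D by (intro card_image_le finite_PiE) auto
  finally show "cover_number P (point_cells T P p D) \<le> card (topspace T) ^ card D"
    using D by (simp add: card_PiE)
  show "card (topspace T) ^ card D \<le> cover_number P (point_cells T P p D)"
    by (intro separates_cover_number point_cells_open_covers separates_point_cells T D order_refl)
qed

text \<open>A cell over \<open>E\<close> cannot detect a change of value at a coordinate outside
  \<open>E\<close>. Used in both directions this makes the passage from \<open>D\<close> to its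
  cover injective.\<close>

lemma point_cells_le_imp_subset:
  assumes ab: "a \<in> topspace T" "b \<in> topspace T" "a \<noteq> b"
    and D: "D \<subseteq> X" and E: "E \<subseteq> X" and eq: "point_cells T P p D \<subseteq> point_cells T P p E"
  shows "D \<subseteq> E"
proof (rule ccontr)
  assume "\<not> D \<subseteq> E"
  then obtain x where x: "x \<in> D" "x \<notin> E" by auto
  obtain z where z: "z \<in> topspace P" "\<forall>y\<in>X. p y z = a"
    using lift[of "\<lambda>_. a"] ab by auto
  obtain z' where z': "z' \<in> topspace P" "\<forall>y\<in>X. p y z' = (if y = x then b else a)"
    using lift[of "\<lambda>y. if y = x then b else a"] ab by auto
  have "fiber P p D (\<lambda>_. a) \<in> point_cells T P p E"
    using eq fiber_in_point_cells[of "\<lambda>_. a" D T] ab(1) by auto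
  moreover have "z \<in> fiber P p D (\<lambda>_. a)" using z D by (auto simp: fiber_def)
  ultimately obtain l where l: "fiber P p D (\<lambda>_. a) = fiber P p E l"
    by (elim point_cellsE) auto
  then have "z \<in> fiber P p E l" using \<open>z \<in> fiber P p D (\<lambda>_. a)\<close> by simp
  then have "l y = a" if "y \<in> E" for y using z E that by (fastforce simp: fiber_def)
  then have "z' \<in> fiber P p E l" using z' E x by (auto simp: fiber_def)
  then have "z' \<in> fiber P p D (\<lambda>_. a)" by (simp add: l)
  then have "p x z' = a" using x(1) by (simp add: fiber_def)
  then show False using z'(2) x(1) D ab(3) by auto
qed

text \<open>A point cell fixes every coordinate in \<open>D\<close>, so it lies inside any cylinder
  over \<open>D\<close> that it meets.\<close>

lemma point_cells_cofinal:
  assumes \<U>: "\<U> \<in> open_covers P"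
  obtains D where "finite D" "D \<subseteq> X" "refines (point_cells T P p D) \<U>"
proof -
  obtain D \<W> where D: "finite D" "D \<subseteq> X" and cov: "cylinder P p D ` \<W> \<in> open_covers P"
      and ref: "refines (cylinder P p D ` \<W>) \<U>"
    by (rule finite_cylinder_refinement[OF \<U>])
  have "\<exists>U\<in>\<U>. V \<subseteq> U" if V: "V \<in> point_cells T P p D" for V
  proof (cases "V = {}")
    case True
    \<comment> \<open>The empty cell needs some member of \<open>\<U>\<close> to contain it; one
      exists because the power is nonempty.\<close>
    moreover have "\<Union>\<U> \<noteq> {}" using \<U> power_nonempty by (simp add: open_covers_def)
    ultimately show ?thesis by auto
  next
    case False
    with V obtain k where k: "V = fiber P p D k" by (elim point_cellsE) auto
    from False obtain z where z: "z \<in> V" by auto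
    then have "z \<in> topspace P" by (simp add: k fiber_def)
    then have "z \<in> \<Union>(cylinder P p D ` \<W>)" using cov by (simp add: open_covers_def)
    then obtain w where w: "w \<in> \<W>" "z \<in> cylinder P p D w" by auto
    then have "V \<subseteq> cylinder P p D w" using z by (auto simp: k fiber_def cylinder_def)
    moreover obtain U where "U \<in> \<U>" "cylinder P p D w \<subseteq> U" using ref w(1) by (auto simp: refines_def)
    ultimately show ?thesis by blast
  qed
  then show thesis using D by (intro that) (auto simp: refines_def)
qed

end

section \<open>Shifts on powers\<close>

text \<open>Every member of every trajectory is an intersection of members of \<open>G\<close>, so
  the number of members is bounded independently of the length.\<close>

lemma (in compact_dynamics) cover_rate_zero_if_finite_pullbacks:
  assumes \<C>: "\<C> \<in> open_covers P" and G: "finite G" "\<And>i. cover_pullback P (g ^^ i) \<C> \<subseteq> G"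
  shows "cover_rate \<C> = 0"
proof (rule cover_rate_zero_if_bounded[OF \<C>])
  fix n :: nat assume "0 < n"
  have inter: "cover_pullback P (g ^^ i) \<C> \<subseteq> Inter ` Pow G" for i
  proof
    fix V assume "V \<in> cover_pullback P (g ^^ i) \<C>"
    then have "{V} \<in> Pow G" using G(2) by blast
    then show "V \<in> Inter ` Pow G" by (rule rev_image_eqI) simp
  qed
  \<comment> \<open>The first factor of the trajectory is \<open>\<C>\<close> itself, so it has to
    be recognised as the zeroth pullback.\<close>
  have "cover_pullback P (g ^^ 0) \<C> = \<C>"
  proof -
    have "U \<inter> topspace P = U" if "U \<in> \<C>" for U using \<C> that by (auto simp: open_covers_def)
    then show ?thesis by (simp add: cover_pullback_def)
  qed
  with inter[of 0] have "\<C> \<subseteq> Inter ` Pow G" by simp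
  with \<open>0 < n\<close> have "cover_traj P g \<C> n \<subseteq> Inter ` Pow G"
  proof (induction n rule: nat_induct_non_zero)
    case 1
    then show ?case by (simp add: cover_traj_1)
  next
    case (Suc n)
    show ?case
    proof
      fix W assume "W \<in> cover_traj P g \<C> (Suc n)"
      then have "W \<in> cover_join (cover_traj P g \<C> n) (cover_pullback P (g ^^ n) \<C>)"
        using Suc.hyps by (simp add: cover_traj_Suc)
      then obtain U V where "W = U \<inter> V" "U \<in> cover_traj P g \<C> n" "V \<in> cover_pullback P (g ^^ n) \<C>"
        unfolding cover_join_def by blast
      moreover then have "U \<in> Inter ` Pow G" "V \<in> Inter ` Pow G"
        using Suc.IH[OF Suc.prems] inter[of n] by (simp_all add: subset_iff)
      moreover then obtain A B where "A \<subseteq> G" "U = \<Inter>A" "B \<subseteq> G" "V = \<Inter>B"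
        by (elim imageE) (simp only: Pow_iff)
      ultimately have "A \<union> B \<in> Pow G" "W = \<Inter>(A \<union> B)" by auto
      then show "W \<in> Inter ` Pow G" by blast
    qed
  qed
  moreover have "finite (Inter ` Pow G)" using G(1) by simp
  ultimately have fin: "finite (cover_traj P g \<C> n)"
      and card: "card (cover_traj P g \<C> n) \<le> card (Inter ` Pow G)"
    by (auto intro: finite_subset card_mono)
  have "cover_number P (cover_traj P g \<C> n) \<le> card (cover_traj P g \<C> n)"
    using traj_open_covers[OF \<C>, of n] fin by (intro cover_number_le) (auto simp: open_covers_def)
  with card show "cover_number P (cover_traj P g \<C> n) \<le> card (Inter ` Pow G)" by simp
qed

locale shift = topological_power P T X p
  for P :: "'b topology" and T :: "'c topology" and X :: "'a set" and p :: "'a \<Rightarrow> 'b \<Rightarrow> 'c" +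
  fixes \<phi> :: "'a \<Rightarrow> 'a" and g :: "'b \<Rightarrow> 'b"
  assumes selfmap: "\<phi> \<in> X \<rightarrow>\<^sub>E X" and continuous_shift: "continuous_map P P g"
    and equivariant: "\<And>x z. x \<in> X \<Longrightarrow> z \<in> topspace P \<Longrightarrow> p x (g z) = p (\<phi> x) z"
begin

sublocale compact_dynamics P g
  by unfold_locales (simp_all only: compact_power power_nonempty continuous_shift not_False_eq_True)

lemma funpow_mem: "z \<in> topspace P \<Longrightarrow> (g ^^ i) z \<in> topspace P"
  using continuous_map_funspace[OF continuous_map_funpow[OF continuous_shift]] by blast

lemma funpow_equivariant:
  "x \<in> X \<Longrightarrow> z \<in> topspace P \<Longrightarrow> p x ((g ^^ i) z) = p ((\<phi> ^^ i) x) z"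
proof (induction i arbitrary: x)
  case (Suc i)
  have "p x ((g ^^ Suc i) z) = p (\<phi> x) ((g ^^ i) z)"
    using Suc.prems funpow_mem equivariant by simp
  also have "\<dots> = p ((\<phi> ^^ i) (\<phi> x)) z" using Suc.prems selfmap by (intro Suc.IH) auto
  finally show ?case by (simp add: funpow_swap1)
qed simp

text \<open>Pullbacks move the support along \<open>\<phi>\<close> and joins unite supports. At
  index 0, \<open>set_traj\<close> is empty while \<open>cover_traj\<close> is the given
  cover.\<close>

lemma traj_point_cells:
  assumes "D \<subseteq> X" "0 < n"
  shows "cover_traj P g (point_cells T P p D) n = point_cells T P p (set_traj \<phi> D n)"
  using assms(2)
proof (induction n rule: nat_induct_non_zero)
  case 1
  show ?case by (simp add: cover_traj_1 set_traj_1)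
next
  case (Suc n)
  have "cover_pullback P (g ^^ n) (point_cells T P p D) = point_cells T P p ((\<phi> ^^ n) ` D)"
    using assms(1) by (intro point_cells_pullback funpow_mem funpow_equivariant) auto
  then show ?case
    using Suc by (simp add: cover_traj_Suc set_traj_Suc point_cells_join)
qed

lemma separates_traj:
  assumes "D \<subseteq> X" "separates p F \<U> D" "0 < n"
  shows "separates p F (cover_traj P g \<U> n) (set_traj \<phi> D n)"
  using assms(3)
proof (induction n rule: nat_induct_non_zero)
  case 1
  show ?case using assms(2) by (simp add: cover_traj_1 set_traj_1)
next
  case (Suc n)
  have "separates p F (cover_pullback P (g ^^ n) \<U>) ((\<phi> ^^ n) ` D)"
    using assms by (intro separates_pullback funpow_equivariant) auto
  then show ?case
    using Suc by (simp only: cover_traj_Suc set_traj_Suc separates_join)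
qed

text \<open>The trajectory of \<open>\<U>\<close> separates the trajectory of \<open>D\<close>, so
  its cover number is at least \<open>card F\<close> to the power of the cardinality of that
  trajectory. Taking logarithms and averaging gives the bound in the limit.\<close>

lemma cover_rate_separated_ge:
  assumes \<U>: "\<U> \<in> open_covers P" and sep: "separates p F \<U> D"
    and D: "finite D" "D \<subseteq> X" and F: "finite F" "F \<noteq> {}" "F \<subseteq> topspace T"
  shows "ln (real (card F)) * traj_rate \<phi> D \<le> cover_rate \<U>"
proof (rule LIMSEQ_le[OF tendsto_mult_left[OF traj_rate_LIMSEQ[OF D(1)]] cover_rate_LIMSEQ[OF \<U>]],
    intro exI[of _ 1] allI impI)
  fix n :: nat assume n: "1 \<le> n"
  have "card F ^ card (set_traj \<phi> D n) \<le> cover_number P (cover_traj P g \<U> n)"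
    using n D sep
    by (intro separates_cover_number[OF traj_open_covers[OF \<U>] separates_traj] finite_set_traj
        set_traj_subset[OF selfmap] F) auto
  then have "real (card F) ^ card (set_traj \<phi> D n) \<le> real (cover_number P (cover_traj P g \<U> n))"
    by (metis of_nat_mono of_nat_power)
  moreover have "0 < real (card F)" using F by (simp add: card_gt_0_iff)
  ultimately have "ln (real (card F) ^ card (set_traj \<phi> D n)) \<le> log_number \<U> n"
    unfolding log_number_def by (intro ln_mono) auto
  then have "real (card (set_traj \<phi> D n)) * ln (real (card F)) \<le> log_number \<U> n"
    using \<open>0 < real (card F)\<close> by (simp add: ln_realpow)
  then have "real (card (set_traj \<phi> D n)) * ln (real (card F)) / real n \<le> log_number \<U> n / real n"
    by (intro divide_right_mono) auto
  then show "ln (real (card F)) * (real (card (set_traj \<phi> D n)) / real n) \<le> log_number \<U> n / real n"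
    by (simp add: mult.commute)
qed

lemma cover_rate_point_cells:
  assumes T: "finite (topspace T)" and D: "finite D" "D \<subseteq> X"
  shows "cover_rate (point_cells T P p D) = ln (real (card (topspace T))) * traj_rate \<phi> D"
proof (rule LIMSEQ_unique[OF cover_rate_LIMSEQ[OF point_cells_open_covers[OF T D]]])
  have pos: "0 < real (card (topspace T))" using T base_nonempty by (metis card_gt_0_iff of_nat_0_less_iff)
  have "log_number (point_cells T P p D) n / real n
      = ln (real (card (topspace T))) * (real (card (set_traj \<phi> D n)) / real n)" if "1 \<le> n" for n
    using that pos set_traj_subset[OF selfmap D(2)]
    by (simp add: log_number_def traj_point_cells[OF D(2)] cover_number_point_cells[OF T]
        finite_set_traj D(1) ln_realpow)
  then have "\<forall>\<^sub>F n in sequentially. ln (real (card (topspace T))) * (real (card (set_traj \<phi> D n)) / real n)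
      = log_number (point_cells T P p D) n / real n"
    by (intro eventually_sequentiallyI[of 1]) simp
  from Lim_transform_eventually[OF tendsto_mult_left[OF traj_rate_LIMSEQ[OF D(1)]] this]
  show "(\<lambda>n. log_number (point_cells T P p D) n / real n)
      \<longlonglongrightarrow> ln (real (card (topspace T))) * traj_rate \<phi> D" .
qed

section \<open>Topological entropy of shifts over finite and infinite bases\<close>

theorem top_entropy_finite_base:
  assumes T: "finite (topspace T)"
  shows "top_entropy P g = ereal (ln (real (card (topspace T)))) * set_entropy X \<phi>"
proof -
  let ?\<D> = "{D. finite D \<and> D \<subseteq> X}" and ?c = "ln (real (card (topspace T)))"
  have "card (topspace T) \<noteq> 0" using T base_nonempty by (metis card_0_eq)
  then have c: "0 \<le> ?c" by simp
  have "top_entropy P g = (SUP D\<in>?\<D>. ereal (?c * traj_rate \<phi> D))"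
  proof (rule antisym)
    show "top_entropy P g \<le> (SUP D\<in>?\<D>. ereal (?c * traj_rate \<phi> D))"
      unfolding top_entropy_eq
    proof (rule SUP_least)
      fix \<U> assume \<U>: "\<U> \<in> open_covers P"
      \<comment> \<open>By cofinality the rate of any cover is dominated by the rate of some point
        cells, which is known exactly.\<close>
      then obtain D where D: "finite D" "D \<subseteq> X" "refines (point_cells T P p D) \<U>"
        by (rule point_cells_cofinal)
      have "cover_rate \<U> \<le> cover_rate (point_cells T P p D)"
        by (intro cover_rate_mono point_cells_open_covers T D \<U>)
      then have "ereal (cover_rate \<U>) \<le> ereal (?c * traj_rate \<phi> D)"
        by (simp add: cover_rate_point_cells T D)
      with D(1,2) show "ereal (cover_rate \<U>) \<le> (SUP D\<in>?\<D>. ereal (?c * traj_rate \<phi> D))"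
        by (intro SUP_upper2[of D]) auto
    qed
    show "(SUP D\<in>?\<D>. ereal (?c * traj_rate \<phi> D)) \<le> top_entropy P g"
      unfolding top_entropy_eq
    proof (rule SUP_least)
      fix D assume "D \<in> ?\<D>"
      then show "ereal (?c * traj_rate \<phi> D) \<le> (SUP \<U>\<in>open_covers P. ereal (cover_rate \<U>))"
        by (intro SUP_upper2[of "point_cells T P p D"])
          (simp_all add: cover_rate_point_cells point_cells_open_covers T)
    qed
  qed
  also have "\<dots> = (SUP D\<in>?\<D>. ereal ?c * ereal (traj_rate \<phi> D))" by simp
  also have "\<dots> = ereal ?c * set_entropy X \<phi>"
    unfolding set_entropy_eq using c
    by (intro SUP_ereal_mult_left) (auto simp: traj_rate_nonneg)
  finally show ?thesis .
qed

lemma top_entropy_zero: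
  assumes zero: "\<And>D. finite D \<Longrightarrow> D \<subseteq> X \<Longrightarrow> traj_rate \<phi> D = 0"
  shows "top_entropy P g = 0"
proof -
  have rate: "cover_rate \<U> = 0" if \<U>: "\<U> \<in> open_covers P" for \<U>
  proof -
    obtain D \<W> where D: "finite D" "D \<subseteq> X" and \<W>: "finite \<W>"
        and cov: "cylinder P p D ` \<W> \<in> open_covers P" and ref: "refines (cylinder P p D ` \<W>) \<U>"
      by (rule finite_cylinder_refinement[OF \<U>])
    obtain n where n: "\<And>i. (\<phi> ^^ i) ` D \<subseteq> set_traj \<phi> D n"
      using traj_rate_zero_imp_bounded[OF D(1) zero[OF D]] by blast
    \<comment> \<open>Members of \<open>G\<close> are boxes with coordinates re-indexed by a map
      \<open>s\<close> from \<open>D\<close> into a finite trajectory; pulling back along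
      \<open>g ^^ i\<close> re-indexes by \<open>\<phi> ^^ i\<close>.\<close>
    define G where "G = (\<lambda>(s, w). {z \<in> topspace P. \<forall>x\<in>D. p (s x) z \<in> w x}) `
      ((D \<rightarrow>\<^sub>E set_traj \<phi> D n) \<times> \<W>)"
    have "cover_rate (cylinder P p D ` \<W>) = 0"
    proof (rule cover_rate_zero_if_finite_pullbacks[OF cov])
      show "finite G"
        unfolding G_def using D(1) \<W> by (intro finite_imageI finite_cartesian_product finite_PiE finite_set_traj)
      fix i
      show "cover_pullback P (g ^^ i) (cylinder P p D ` \<W>) \<subseteq> G"
      proof
        fix V assume "V \<in> cover_pullback P (g ^^ i) (cylinder P p D ` \<W>)"
        then obtain w where w: "w \<in> \<W>" "V = (g ^^ i) -` cylinder P p D w \<inter> topspace P"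
          by (auto simp: cover_pullback_def)
        have "V = {z \<in> topspace P. \<forall>x\<in>D. p (restrict (\<phi> ^^ i) D x) z \<in> w x}"
        proof -
          have "p x ((g ^^ i) z) = p (restrict (\<phi> ^^ i) D x) z" if "z \<in> topspace P" "x \<in> D" for x z
            using that D(2) by (simp add: funpow_equivariant subset_iff)
          then show ?thesis
            unfolding w(2) cylinder_def by (auto simp: funpow_mem simp del: restrict_apply restrict_apply')
        qed
        moreover have "restrict (\<phi> ^^ i) D \<in> D \<rightarrow>\<^sub>E set_traj \<phi> D n" using n by auto
        ultimately show "V \<in> G"
          unfolding G_def using w(1) by (intro image_eqI[of _ _ "(restrict (\<phi> ^^ i) D, w)"]) auto
      qed
    qed
    with cover_rate_mono[OF cov \<U> ref] cover_rate_nonneg[OF \<U>] show ?thesis by simp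
  qed
  \<comment> \<open>An empty supremum in \<open>ereal\<close> would be -\<infinity>, so some cover
    has to be exhibited.\<close>
  have "{topspace P} \<in> open_covers P" by (simp add: open_covers_def)
  then have "open_covers P \<noteq> {}" by blast
  then show ?thesis
    unfolding top_entropy_eq using rate by (simp add: zero_ereal_def)
qed

theorem top_entropy_infinite_base:
  assumes T: "infinite (topspace T)"
  shows "top_entropy P g = \<infinity> * set_entropy X \<phi>"
proof (cases "\<exists>D. finite D \<and> D \<subseteq> X \<and> traj_rate \<phi> D \<noteq> 0")
  case False
  then have "set_entropy X \<phi> = (SUP D\<in>{D. finite D \<and> D \<subseteq> X}. 0)"
    unfolding set_entropy_eq by (intro SUP_cong) (auto simp: zero_ereal_def)
  also have "\<dots> = 0" by (rule SUP_const) auto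
  finally show ?thesis using top_entropy_zero False by auto
next
  case True
  then obtain D where D: "finite D" "D \<subseteq> X" "traj_rate \<phi> D \<noteq> 0" by auto
  define r where "r = traj_rate \<phi> D"
  have r: "0 < r" using D traj_rate_nonneg[OF D(1), of \<phi>] by (simp add: r_def)
  have "ereal r \<le> set_entropy X \<phi>"
    unfolding set_entropy_eq r_def using D by (intro SUP_upper) auto
  then have pos: "0 < set_entropy X \<phi>" using r by (meson ereal_less(2) less_le_trans)
  have "ereal B \<le> top_entropy P g" for B
  proof -
    \<comment> \<open>With this \<open>m\<close>, the separation bound \<open>r * ln m\<close>
      reaches \<open>B\<close>.\<close>
    obtain m :: nat where m: "exp (B / r) \<le> real m" using real_arch_simple by blast
    obtain F where F: "finite F" "card F = m" "F \<subseteq> topspace T"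
      using infinite_arbitrarily_large[OF T] by blast
    have "0 < real m" using m exp_gt_zero[of "B / r"] by linarith
    with F have "F \<noteq> {}" by auto
    have cov: "cells T P p F D \<in> open_covers P"
      by (intro cells_open_covers D F \<open>F \<noteq> {}\<close>)
    have "B / r \<le> ln (real m)" using m \<open>0 < real m\<close> by (simp add: ln_ge_iff)
    then have "B \<le> ln (real (card F)) * traj_rate \<phi> D" using r F(2) by (simp add: r_def divide_le_eq)
    also have "\<dots> \<le> cover_rate (cells T P p F D)"
      by (intro cover_rate_separated_ge cov separates_cells D F \<open>F \<noteq> {}\<close>)
    finally show ?thesis
      unfolding top_entropy_eq using cov by (intro SUP_upper2[of "cells T P p F D"]) auto
  qed
  then have "top_entropy P g = \<infinity>" by (rule ereal_top)
  with pos show ?thesis by simp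
qed

end

section \<open>Contravariant functors turning coproducts into products\<close>

text \<open>Contravariance turns the inclusion of the point \<open>x\<close> into a projection from
  \<open>\<epsilon> X\<close> to the base.\<close>

definition coordinate ::
    "('a set, 'a, 'b topology, 'b) functor_data \<Rightarrow> 'a \<Rightarrow> 'a set \<Rightarrow> 'a \<Rightarrow> 'b \<Rightarrow> 'b" where
  "coordinate \<epsilon> pt X x = Ar \<epsilon> {pt} X (\<lambda>_\<in>{pt}. x)"

locale coproducts_to_products_functor =
  fixes \<epsilon> :: "('a set, 'a, 'b topology, 'b) functor_data" and pt :: 'a
  assumes contravariant: "contravariant_functor Set_cat CTop2 \<epsilon>"
    and coproducts: "coproducts_to_products \<epsilon>"
    and base_nonempty: "topspace (Ob \<epsilon> {pt}) \<noteq> {}"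
begin

lemma compact_Hausdorff_Ob: "compact_space (Ob \<epsilon> X)" "Hausdorff_space (Ob \<epsilon> X)"
  using contravariant by (auto simp: contravariant_functor_def Set_cat_def CTop2_def)

lemma Ar_continuous: "f \<in> X \<rightarrow>\<^sub>E Y \<Longrightarrow> continuous_map (Ob \<epsilon> Y) (Ob \<epsilon> X) (Ar \<epsilon> X Y f)"
  using contravariant by (simp add: contravariant_functor_def Set_cat_def CTop2_def)

lemma Ar_compose:
  assumes "f \<in> X \<rightarrow>\<^sub>E Y" "g \<in> Y \<rightarrow>\<^sub>E Z"
  shows "Ar \<epsilon> X Z (compose X g f) = compose (topspace (Ob \<epsilon> Z)) (Ar \<epsilon> X Y f) (Ar \<epsilon> Y Z g)"
  using contravariant assms by (simp add: contravariant_functor_def Set_cat_def CTop2_def)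

text \<open>Composing the inclusion of \<open>x\<close> with \<open>f\<close> gives the inclusion of
  \<open>f x\<close>; under \<open>\<epsilon>\<close> this says that
  \<open>Ar \<epsilon> X Y f\<close> is precomposition with \<open>f\<close> in coordinates.\<close>

lemma coordinate_natural:
  assumes f: "f \<in> X \<rightarrow>\<^sub>E Y" and x: "x \<in> X" and z: "z \<in> topspace (Ob \<epsilon> Y)"
  shows "coordinate \<epsilon> pt X x (Ar \<epsilon> X Y f z) = coordinate \<epsilon> pt Y (f x) z"
proof -
  have "compose {pt} f (\<lambda>_\<in>{pt}. x) = (\<lambda>_\<in>{pt}. f x)"
    by (auto simp: compose_def restrict_def)
  moreover have "(\<lambda>_\<in>{pt}. x) \<in> {pt} \<rightarrow>\<^sub>E X" using x by auto
  ultimately have "coordinate \<epsilon> pt Y (f x)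
      = compose (topspace (Ob \<epsilon> Y)) (coordinate \<epsilon> pt X x) (Ar \<epsilon> X Y f)"
    unfolding coordinate_def using Ar_compose f by metis
  then show ?thesis using z by (simp add: compose_eq)
qed

lemma is_product_coordinates:
  "is_product CTop2 X (\<lambda>_. Ob \<epsilon> {pt}) (Ob \<epsilon> X) (coordinate \<epsilon> pt X)"
proof -
  \<comment> \<open>\<open>X\<close> indexes its own points, so the index set lies in the universe
    \<open>'a\<close>, as \<open>coproducts_to_products\<close> demands.\<close>
  have "is_set_coproduct X (\<lambda>_. {pt}) X (\<lambda>x. \<lambda>_\<in>{pt}. x)"
    unfolding is_set_coproduct_def by (auto simp: bij_betw_def inj_on_def image_def)
  then show ?thesis
    using coproducts unfolding coproducts_to_products_def coordinate_def by fastforce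
qed

text \<open>
  Only maps from a one-point space are tested against the universal property: they give a continuous
  bijection onto the power, which is a homeomorphism by compactness.
\<close>

lemma coordinates_power: "topological_power (Ob \<epsilon> X) (Ob \<epsilon> {pt}) X (coordinate \<epsilon> pt X)"
proof
  let ?P = "Ob \<epsilon> X" and ?T = "Ob \<epsilon> {pt}" and ?p = "coordinate \<epsilon> pt X"
  let ?h = "\<lambda>z. \<lambda>x\<in>X. ?p x z"
  show "compact_space ?P" "Hausdorff_space ?T" "topspace ?T \<noteq> {}"
    by (rule compact_Hausdorff_Ob base_nonempty)+
  \<comment> \<open>Arrows from \<open>Q\<close> amount to points of the target: existence in the
    universal property gives surjectivity of \<open>?h\<close>, uniqueness gives
    injectivity.\<close>
  define Q :: "'b topology" where "Q = discrete_topology {undefined}"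
  have Q: "topspace Q = {undefined}" by (simp add: Q_def)
  have Q_Obj: "Q \<in> Obj CTop2"
    by (simp add: CTop2_def Q_def compact_space_discrete_topology)
  have const: "(\<lambda>_\<in>{undefined}. y) \<in> Hom CTop2 Q Y" if "y \<in> topspace Y" for y and Y :: "'b topology"
    using that by (auto simp: CTop2_def Q_def Pi_iff)
  have univ: "\<exists>!h. h \<in> Hom CTop2 Q ?P \<and> (\<forall>x\<in>X. compose {undefined} (?p x) h = f x)"
    if "\<And>x. x \<in> X \<Longrightarrow> f x \<in> Hom CTop2 Q ?T" for f
  proof -
    have "Und CTop2 Q = {undefined}" by (simp add: CTop2_def Q)
    then show ?thesis
      using is_product_coordinates[of X] Q_Obj that unfolding is_product_def by metis
  qed
  have p_cont: "continuous_map ?P ?T (?p x)" if "x \<in> X" for x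
    unfolding coordinate_def using that by (intro Ar_continuous) auto
  have p_mem: "?p x z \<in> topspace ?T" if "x \<in> X" "z \<in> topspace ?P" for x z
    using continuous_map_funspace[OF p_cont] that by auto
  show "homeomorphic_map ?P (product_topology (\<lambda>_. ?T) X) ?h"
  proof (rule continuous_imp_homeomorphic_map)
    show "compact_space ?P" by (rule compact_Hausdorff_Ob)
    show "Hausdorff_space (product_topology (\<lambda>_. ?T) X)"
      by (simp add: Hausdorff_space_product_topology compact_Hausdorff_Ob)
    show "continuous_map ?P (product_topology (\<lambda>_. ?T) X) ?h"
      using p_cont by (auto simp: continuous_map_componentwise)
    show "?h ` topspace ?P = topspace (product_topology (\<lambda>_. ?T) X)"
    proof (intro equalityI subsetI)
      fix k assume "k \<in> ?h ` topspace ?P"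
      then show "k \<in> topspace (product_topology (\<lambda>_. ?T) X)" using p_mem by auto
    next
      fix k assume "k \<in> topspace (product_topology (\<lambda>_. ?T) X)"
      then have k: "k \<in> X \<rightarrow>\<^sub>E topspace ?T" by simp
      have "\<exists>!h. h \<in> Hom CTop2 Q ?P \<and>
          (\<forall>x\<in>X. compose {undefined} (?p x) h = (\<lambda>_\<in>{undefined}. k x))"
        using k by (intro univ const) auto
      then obtain h where h: "h \<in> Hom CTop2 Q ?P"
          "\<forall>x\<in>X. compose {undefined} (?p x) h = (\<lambda>_\<in>{undefined}. k x)"
        by (elim ex1E conjE)
      have "?p x (h undefined) = k x" if "x \<in> X" for x
        using fun_cong[OF bspec[OF h(2) that], of undefined] by (simp add: compose_eq)
      then have "k = ?h (h undefined)"
        using k by (intro ext) (auto simp: PiE_iff extensional_def)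
      moreover have "h undefined \<in> topspace ?P" using CTop2_Hom_PiE[OF h(1)] Q by auto
      ultimately show "k \<in> ?h ` topspace ?P" by blast
    qed
    show "inj_on ?h (topspace ?P)"
    proof (rule inj_onI)
      fix z z' assume z: "z \<in> topspace ?P" "z' \<in> topspace ?P" and eq: "?h z = ?h z'"
      have p_eq: "?p x z = ?p x z'" if "x \<in> X" for x using fun_cong[OF eq, of x] that by simp
      let ?R = "\<lambda>h. h \<in> Hom CTop2 Q ?P \<and>
          (\<forall>x\<in>X. compose {undefined} (?p x) h = (\<lambda>_\<in>{undefined}. ?p x z))"
      have comp: "compose {undefined} (?p x) (\<lambda>_\<in>{undefined}. y) = (\<lambda>_\<in>{undefined}. ?p x y)" for x y
        by (auto simp: compose_def restrict_def)
      have "\<exists>!h. ?R h" using z p_mem by (intro univ const) auto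
      moreover have "?R (\<lambda>_\<in>{undefined}. z)" by (intro conjI ballI const comp z)
      moreover have "?R (\<lambda>_\<in>{undefined}. z')"
        by (intro conjI ballI const z) (simp only: comp p_eq)
      ultimately have "(\<lambda>_\<in>{undefined}. z) = (\<lambda>_\<in>{undefined :: 'b}. z')" by (elim ex1E) blast
      from fun_cong[OF this, of undefined] show "z = z'" by simp
    qed
  qed
qed

sublocale power: topological_power "Ob \<epsilon> X" "Ob \<epsilon> {pt}" X "coordinate \<epsilon> pt X" for X
  by (rule coordinates_power)

lemma shift_Ar: "\<phi> \<in> X \<rightarrow>\<^sub>E X \<Longrightarrow> shift (Ob \<epsilon> X) (Ob \<epsilon> {pt}) X (coordinate \<epsilon> pt X) \<phi> (Ar \<epsilon> X X \<phi>)"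
  by (intro shift.intro coordinates_power shift_axioms.intro Ar_continuous coordinate_natural)

section \<open>The natural transformation from finite sets to open covers\<close>

definition cells_cover :: "'a set \<Rightarrow> 'a set \<Rightarrow> 'b set set" where
  "cells_cover X = (\<lambda>D\<in>{D. finite D \<and> D \<subseteq> X}. point_cells (Ob \<epsilon> {pt}) (Ob \<epsilon> X) (coordinate \<epsilon> pt X) D)"

lemma cells_cover_sgp_hom:
  assumes "finite (topspace (Ob \<epsilon> {pt}))"
  shows "cells_cover X \<in> sgp_hom (Ob im_functor X) (Ob (comp_contra cov_functor \<epsilon>) X)"
  unfolding sgp_hom_def
  by (auto simp: cells_cover_def im_functor_def cov_functor_def comp_contra_def
      power.point_cells_open_covers[OF assms] point_cells_join)

text \<open>Naturality is \<open>point_cells_pullback\<close>: taking images of finite sets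
  corresponds to pulling covers back.\<close>

lemma cells_cover_nat_trans:
  assumes fin: "finite (topspace (Ob \<epsilon> {pt}))"
  shows "sgp_nat_trans Set_cat im_functor (comp_contra cov_functor \<epsilon>) cells_cover"
  unfolding sgp_nat_trans_def
proof (intro conjI ballI)
  show "cells_cover X \<in> sgp_hom (Ob im_functor X) (Ob (comp_contra cov_functor \<epsilon>) X)" for X
    by (rule cells_cover_sgp_hom[OF fin])
  fix X Y :: "'a set" and f assume "f \<in> Hom Set_cat X Y"
  then have f: "f \<in> X \<rightarrow>\<^sub>E Y" by (simp add: Set_cat_def)
  have "cover_pullback (Ob \<epsilon> Y) (Ar \<epsilon> X Y f) (point_cells (Ob \<epsilon> {pt}) (Ob \<epsilon> X) (coordinate \<epsilon> pt X) D)
      = point_cells (Ob \<epsilon> {pt}) (Ob \<epsilon> Y) (coordinate \<epsilon> pt Y) (f ` D)" if "D \<subseteq> X" for D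
    using that continuous_map_funspace[OF Ar_continuous[OF f]]
    by (intro point_cells_pullback coordinate_natural f) auto
  moreover have "f ` D \<subseteq> Y" if "D \<subseteq> X" for D using f that by auto
  ultimately show "compose (car (Ob im_functor X)) (cells_cover Y) (Ar im_functor X Y f) =
      compose (car (Ob im_functor X)) (Ar (comp_contra cov_functor \<epsilon>) X Y f) (cells_cover X)"
    unfolding compose_def
    by (intro restrict_ext)
      (simp add: cells_cover_def im_functor_def cov_functor_def comp_contra_def
        power.point_cells_open_covers[OF fin])
qed

text \<open>Injectivity comes from two distinct values of the base, the norm identity is the
  logarithm of the count of cells, and cofinality is refinement by point cells.\<close>

lemma cells_cover_weak_isomorphism:
  assumes fin: "finite (topspace (Ob \<epsilon> {pt}))"
    and ab: "a \<in> topspace (Ob \<epsilon> {pt})" "b \<in> topspace (Ob \<epsilon> {pt})" "a \<noteq> b"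
  shows "weak_isomorphism (ln (real (card (topspace (Ob \<epsilon> {pt})))))
    (Ob im_functor X) (Ob (comp_contra cov_functor \<epsilon>) X) (cells_cover X)"
  unfolding weak_isomorphism_def
proof (intro conjI ballI)
  let ?K = "topspace (Ob \<epsilon> {pt})"
  \<comment> \<open>At least two points in the base make the coefficient positive.\<close>
  have "card {a, b} \<le> card ?K" using ab by (intro card_mono fin) auto
  then have card: "2 \<le> card ?K" using ab by simp
  then show "0 < ln (real (card ?K))" by simp
  show "cells_cover X \<in> sgp_hom (Ob im_functor X) (Ob (comp_contra cov_functor \<epsilon>) X)"
    by (rule cells_cover_sgp_hom[OF fin])
  show "inj_on (cells_cover X) (car (Ob im_functor X))"
  proof (rule inj_onI)
    fix D E
    assume "D \<in> car (Ob im_functor X)" "E \<in> car (Ob im_functor X)" "cells_cover X D = cells_cover X E"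
    then have "D \<subseteq> X" "E \<subseteq> X" and "point_cells (Ob \<epsilon> {pt}) (Ob \<epsilon> X) (coordinate \<epsilon> pt X) D
        = point_cells (Ob \<epsilon> {pt}) (Ob \<epsilon> X) (coordinate \<epsilon> pt X) E"
      by (simp_all add: im_functor_def cells_cover_def)
    then show "D = E"
      using power.point_cells_le_imp_subset[OF ab, of D X E]
        power.point_cells_le_imp_subset[OF ab, of E X D] by simp
  qed
  show "nrm (Ob (comp_contra cov_functor \<epsilon>) X) (cells_cover X D) = ln (real (card ?K)) * nrm (Ob im_functor X) D"
    if "D \<in> car (Ob im_functor X)" for D
    using that card
    by (simp add: im_functor_def cov_functor_def comp_contra_def cells_cover_def
        power.cover_number_point_cells[OF fin] ln_realpow)
  show "\<exists>D\<in>car (Ob im_functor X). leq (Ob (comp_contra cov_functor \<epsilon>) X) \<U> (cells_cover X D)"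
    if "\<U> \<in> car (Ob (comp_contra cov_functor \<epsilon>) X)" for \<U>
  proof -
    have "\<U> \<in> open_covers (Ob \<epsilon> X)" using that by (simp add: cov_functor_def comp_contra_def)
    then obtain D where "finite D" "D \<subseteq> X"
        "refines (point_cells (Ob \<epsilon> {pt}) (Ob \<epsilon> X) (coordinate \<epsilon> pt X) D) \<U>"
      by (rule power.point_cells_cofinal)
    then show ?thesis
      by (intro bexI[of _ D])
        (simp_all add: im_functor_def cov_functor_def comp_contra_def cells_cover_def refines_def)
  qed
qed

end

text \<open>By \<open>shift_Ar\<close> each \<open>Ar \<epsilon> X X \<phi>\<close> is a shift on a
  power of the base, so both entropy formulas are instances of the computations for shifts; the weak
  isomorphisms are given by \<open>cells_cover\<close>.\<close>

theorem theorem6p33: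
  fixes \<epsilon> :: "('a set, 'a, 'b topology, 'b) functor_data"
    and pt :: 'a
    and K :: "'b set"
  assumes K: "K = topspace (Ob \<epsilon> {pt})"
    and contravariant: "contravariant_functor Set_cat CTop2 \<epsilon>"
    and coproducts: "coproducts_to_products \<epsilon>"
    and nontrivial: "\<exists>x\<in>K. \<exists>y\<in>K. x \<noteq> y"
  shows "(infinite K \<longrightarrow> BT Set_cat \<epsilon> \<infinity> set_entropy top_entropy) \<and>
         (finite K \<longrightarrow> SBT_weak Set_cat \<epsilon> (ln (real (card K))) im_functor cov_functor) \<and>
         BT Set_cat \<epsilon> (if finite K then ereal (ln (real (card K))) else \<infinity>) set_entropy top_entropy"
proof -
  obtain a b where ab: "a \<in> K" "b \<in> K" "a \<noteq> b" using nontrivial by blast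
  interpret coproducts_to_products_functor \<epsilon> pt
    using contravariant coproducts ab K by unfold_locales auto
  have infinite: "BT Set_cat \<epsilon> \<infinity> set_entropy top_entropy" if "infinite K"
    using that shift.top_entropy_infinite_base[OF shift_Ar] K by (simp add: BT_def Set_cat_def)
  have SBT: "SBT_weak Set_cat \<epsilon> (ln (real (card K))) im_functor cov_functor" if "finite K"
    using that ab cells_cover_nat_trans cells_cover_weak_isomorphism
    unfolding K SBT_weak_def by (metis weak_isomorphism_def)
  moreover have "BT Set_cat \<epsilon> (ereal (ln (real (card K)))) set_entropy top_entropy" if "finite K"
  proof -
    \<comment> \<open>Only the positivity of the factor is taken from \<open>SBT\<close>; the
      equality of entropies is the direct computation for shifts.\<close>
    have "0 < ln (real (card K))" using SBT[OF that] by (simp add: SBT_weak_def)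
    then show ?thesis
      using that shift.top_entropy_finite_base[OF shift_Ar] K by (simp add: BT_def Set_cat_def)
  qed
  ultimately show ?thesis using infinite by simp
qed

end
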